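(* Let $k\in\mathbb{N}$ and let $(m_1(n))_n,\dots,(m_k(n))_n$ be sequences of positive integers with $m_j(n)\le\alpha(n)$ for all $n$ and all $j$, and (for all sufficiently large $n$) $m_i(n)\neq m_j(n)$ for $i\ne j$. Assume that $\mu_{m_j(n)}(n)\to\infty$ as $n\to\infty$ for all $j$. Assume finally that $a_1>1/7$, where $a_1$ is the exponent in $n^{a_1}\le\alpha(n)\le n^{a_2}$. Define $$\widetilde{C}_{m_j}:=\frac{C_{m_j(n)}-\mu_{m_j(n)}(n)}{\sqrt{\mu_{m_j(n)}(n)}} .$$ Then, under $\mathbb{P}_{n,\alpha}$, $$\big(\widetilde{C}_{m_1},\dots,\widetilde{C}_{m_k}\big)\stackrel{d}{\longrightarrow}(N_1,\dots,N_k)\qquad\text{as }n\to\infty,$$ where $N_1,\dots,N_k$ are independent standard normal random variables.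
   Context: Fix $a_1,a_2\in(0,1)$ and a sequence $\alpha=(\alpha(n))_{n\in\mathbb{N}}$ with $n^{a_1}\le\alpha(n)\le n^{a_2}$. Sums $\sum_{j=1}^{\alpha(n)}$ run over the integers $j$ with $1\le j\le\alpha(n)$. $S_{n,\alpha}$ is the set of permutations of $\{1,\dots,n\}$ all of whose cycles have length at most $\alpha(n)$; $\mathbb{P}_{n,\alpha}$ is the uniform probability measure on $S_{n,\alpha}$. $C_m=C_m(\sigma)$ is the number of cycles of length $m$ in $\sigma$. $x_{n,\alpha}$ is the unique positive solution of $n=\sum_{j=1}^{\alpha(n)}x_{n,\alpha}^{j}$, and $\mu_m(n):=x_{n,\alpha}^m/m$. *)

theory Defs
  imports "HOL-Probability.Probability" "HOL-Combinatorics.Orbits"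
begin

text \<open>The cycles of a permutation \<open>\<sigma>\<close> of \<open>{1..n}\<close> are represented by their supports,
  the orbits of \<open>\<sigma>\<close>; a fixed point is a cycle of length 1.\<close>

definition perm_cycles :: "nat \<Rightarrow> (nat \<Rightarrow> nat) \<Rightarrow> nat set set" where
  "perm_cycles n \<sigma> = orbit \<sigma> ` {1..n}"

definition cycle_count :: "nat \<Rightarrow> nat \<Rightarrow> (nat \<Rightarrow> nat) \<Rightarrow> nat" where
  "cycle_count n m \<sigma> = card {c \<in> perm_cycles n \<sigma>. card c = m}"

text \<open>The cutoff \<open>\<alpha> n\<close> is a real number and need not be an integer.\<close>

definition short_cycle_perms :: "(nat \<Rightarrow> real) \<Rightarrow> nat \<Rightarrow> (nat \<Rightarrow> nat) set" where
  "short_cycle_perms \<alpha> n =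
     {\<sigma>. \<sigma> permutes {1..n} \<and> (\<forall>c\<in>perm_cycles n \<sigma>. real (card c) \<le> \<alpha> n)}"

definition short_cycle_pmf :: "(nat \<Rightarrow> real) \<Rightarrow> nat \<Rightarrow> (nat \<Rightarrow> nat) pmf" where
  "short_cycle_pmf \<alpha> n = pmf_of_set (short_cycle_perms \<alpha> n)"

definition saddle_point :: "(nat \<Rightarrow> real) \<Rightarrow> nat \<Rightarrow> real" where
  "saddle_point \<alpha> n =
     (THE x. x > 0 \<and> real n = (\<Sum>j\<in>{j::nat. 1 \<le> j \<and> real j \<le> \<alpha> n}. x ^ j))"

definition cycle_mu :: "(nat \<Rightarrow> real) \<Rightarrow> nat \<Rightarrow> nat \<Rightarrow> real" where
  "cycle_mu \<alpha> n m = saddle_point \<alpha> n ^ m / real m"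

definition normalized_cycle_count :: "(nat \<Rightarrow> real) \<Rightarrow> nat \<Rightarrow> nat \<Rightarrow> (nat \<Rightarrow> nat) \<Rightarrow> real" where
  "normalized_cycle_count \<alpha> n m \<sigma> =
     (real (cycle_count n m \<sigma>) - cycle_mu \<alpha> n m) / sqrt (cycle_mu \<alpha> n m)"

text \<open>Convergence in distribution of \<open>X n\<close>, defined on \<open>P n\<close>, to \<open>Y\<close>, defined on \<open>Q\<close>:
  weak convergence of the laws, tested against bounded continuous functions
  (the library's \<^const>\<open>weak_conv_m\<close> covers only laws on the real line).\<close>

definition converges_in_distribution ::
  "(nat \<Rightarrow> 'a measure) \<Rightarrow> (nat \<Rightarrow> 'a \<Rightarrow> 'b::topological_space) \<Rightarrow> 'c measure \<Rightarrow> ('c \<Rightarrow> 'b) \<Rightarrow> bool" where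
  "converges_in_distribution P X Q Y \<longleftrightarrow>
     (\<forall>f :: 'b \<Rightarrow> real. continuous_on UNIV f \<and> bounded (range f) \<longrightarrow>
        (\<lambda>n. \<integral>v. f v \<partial>distr (P n) borel (X n)) \<longlonglongrightarrow> (\<integral>v. f v \<partial>distr Q borel Y))"

lemma finite_short_cycle_perms: "finite (short_cycle_perms \<alpha> n)"
  unfolding short_cycle_perms_def
  by (rule finite_subset[OF _ finite_permutations[of "{1..n}"]]) auto

lemma id_in_short_cycle_perms:
  assumes "n \<ge> 1 \<Longrightarrow> \<alpha> n \<ge> 1"
  shows "id \<in> short_cycle_perms \<alpha> n"
proof -
  have "orbit id x = {x}" for x :: nat
    by (auto simp: orbit_altdef)
  then show ?thesis
    using assms by (auto simp: short_cycle_perms_def perm_cycles_def permutes_id)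
qed

lemma saddle_point_ex1:
  assumes n: "n \<ge> 1" and a: "\<alpha> n \<ge> 1"
  shows "\<exists>!x. x > 0 \<and> real n = (\<Sum>j\<in>{j::nat. 1 \<le> j \<and> real j \<le> \<alpha> n}. x ^ j)"
proof -
  define J where "J = {j::nat. 1 \<le> j \<and> real j \<le> \<alpha> n}"
  define g where "g x = (\<Sum>j\<in>J. x ^ j)" for x :: real
  have fin: "finite J"
    by (rule finite_subset[of _ "{..nat \<lfloor>\<alpha> n\<rfloor>}"]) (auto simp: J_def le_nat_floor)
  have J1: "1 \<in> J" using a by (simp add: J_def)
  have mono: "g x < g y" if "0 \<le> x" "x < y" for x y
    unfolding g_def using that J1 fin
    by (intro sum_strict_mono) (auto simp: J_def intro!: power_strict_mono)
  have "g 0 = 0"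
    unfolding g_def by (intro sum.neutral) (auto simp: J_def)
  moreover have "real n ^ 1 \<le> g (real n)"
    unfolding g_def by (rule member_le_sum[OF J1 _ fin]) auto
  moreover have "continuous_on {0..real n} g"
    unfolding g_def by (intro continuous_intros)
  ultimately obtain x where x: "0 \<le> x" "g x = real n"
    using IVT'[of g 0 "real n" "real n"] by auto
  have "x \<noteq> 0" using x n \<open>g 0 = 0\<close> by auto
  have "\<exists>!x. x > 0 \<and> real n = g x"
  proof (rule ex1I[of _ x])
    show "x > 0 \<and> real n = g x" using x \<open>x \<noteq> 0\<close> by simp
    fix y assume "y > 0 \<and> real n = g y"
    then show "y = x" using mono[of x y] mono[of y x] x by (cases x y rule: linorder_cases) auto
  qed
  then show ?thesis by (simp add: g_def J_def)
qed

end

theory Submission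
  imports Defs "HOL-Real_Asymp.Real_Asymp"
begin

text \<open>
  Under the uniform measure on the permutations with cycle lengths at most \<open>N = \<lfloor>\<alpha> n\<rfloor>\<close>, the vector of cycle
  counts is a vector of independent Poisson variables \<open>c j\<close>, \<open>1 \<le> j \<le> N\<close>, conditioned on
  \<open>\<Sum>j. j * c j = n\<close> (\<open>expectation_short_conditioning\<close>, from Cauchy's formula \<open>count_cycle_type\<close> for the number of
  permutations of a given cycle type). The parameters may be \<open>y ^ j / j\<close> for any \<open>y > 0\<close>; the saddle point
  \<open>x\<close> is the choice for which the total \<open>\<Sum>j. j * c j\<close> has mean \<open>n\<close>, so that the conditioning
  event is as likely as possible. For the unconditioned variables the claim is the central limit theorem for Poisson
  variables (\<open>poisson_clt\<close>) together with independence (\<open>weak_convergence_product\<close>).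

  It remains to see that the conditioning does not matter. The total has variance \<open>\<sigma>\<^sup>2 = \<Sum>j. j * x ^ j\<close>, of
  order \<open>n * N\<close>. The marked lengths contribute to it at most a constant times \<open>N * x ^ N\<close>, and \<open>x ^ N\<close> is
  small compared to \<open>n\<close> (\<open>saddle_estimates\<close>). So the bulk of the variables smears out the total over a range much
  longer than the fluctuations of the marked part. Quantitatively, for a bounded function \<open>F\<close> of the marked coordinates,
  Fourier inversion bounds the covariance of \<open>F\<close> with the conditioning event by the standard deviation of the
  marked part times the integral of \<open>|t| * |\<phi> t|\<close>, where \<open>\<phi>\<close> is the characteristic function of the unmarked part
  (\<open>hit_covariance_bound\<close>). If \<open>\<phi>\<close> decays like a Gaussian of variance of order \<open>\<sigma>\<^sup>2\<close>, this integral is of order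
  \<open>1 / \<sigma>\<^sup>2\<close>, and a local limit estimate bounds the probability of the conditioning event from below by a multiple of
  \<open>1 / \<sigma>\<close> (\<open>hit_lower_bound\<close>). Hence the conditioned and the unconditioned expectation of \<open>F\<close> differ by a
  multiple of the standard deviation of the marked part divided by \<open>\<sigma>\<close> (\<open>short_expectation_close_to_law\<close>), which tends to 0.

  The decay of \<open>\<phi>\<close> is Gaussian for \<open>|t| \<le> 1 / N\<close>. For larger \<open>t\<close> it follows from the fact that the sum of the
  \<open>(x * cis t) ^ j\<close> is a geometric sum, which is smaller than \<open>n\<close> by a factor of at most \<open>1 - 1 / (32 * (ln n)\<^sup>2)\<close> up to a
  lower order term (\<open>power_sum_off_axis\<close>). For large \<open>n\<close>, this makes \<open>|\<phi> t|\<close> at most the exponential of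
  \<open>- n / (64 * N * (ln n)\<^sup>2)\<close>, and \<open>n / N\<close> is at least a positive power of \<open>n\<close>.
\<close>

section \<open>Cycle types under insertion of a point\<close>

text \<open>This is \<^const>\<open>cycle_count\<close> for an arbitrary ground set, so that the ground set can grow by one
point at a time in inductions, and with the length as last argument, so that the whole vector of
cycle counts is one object.\<close>

definition cycle_type :: "'a set \<Rightarrow> ('a \<Rightarrow> 'a) \<Rightarrow> nat \<Rightarrow> nat" where
  "cycle_type S \<sigma> j = card {c \<in> orbit \<sigma> ` S. card c = j}"

lemma self_in_orbit_permutes:
  assumes "finite S" "p permutes S"
  shows "x \<in> orbit p x"
  using assms by (intro permutation_self_in_orbit) (auto simp: permutation_permutes)

lemma orbit_eq_permutes:
  assumes "finite S" "p permutes S" "y \<in> orbit p x"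
  shows "orbit p y = orbit p x"
proof -
  have "cyclic_on p (orbit p x)"
    using assms by (intro cyclic_on_orbit) auto
  thus ?thesis using assms(3) orbit_cyclic_eq3 by metis
qed

text \<open>A permutation of \<open>insert a S\<close> that moves \<open>a\<close> arises from one of \<open>S\<close> by inserting \<open>a\<close>
into a cycle, just before the point \<open>b\<close>: \<open>transpose a b \<circ> p\<close> sends the predecessor of \<open>b\<close> to \<open>a\<close> and
\<open>a\<close> to \<open>b\<close>. Hence \<open>a\<close> joins the orbit of \<open>b\<close> and all other orbits stay as they were.\<close>

lemma insert_in_cycle:
  fixes p :: "'a \<Rightarrow> 'a"
  assumes S: "finite S" and p: "p permutes S" and a: "a \<notin> S" and b: "b \<in> S" and x: "x \<in> S"
  defines "\<sigma> \<equiv> Transposition.transpose a b \<circ> p"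
  shows "orbit \<sigma> x = (if b \<in> orbit p x then insert a (orbit p x) else orbit p x)"
proof -
  have pa: "p a = a" using p a by (simp add: permutes_not_in)
  have \<sigma>p: "\<sigma> permutes insert a S"
    unfolding \<sigma>_def using p b 
    by (intro permutes_compose permutes_swap_id permutes_imp_permutes_insert) auto
  have subS: "orbit p x \<subseteq> S" using permutes_orbit_subset[OF p x] .
  have \<sigma>a: "\<sigma> a = b" by (simp add: \<sigma>_def pa)
  have \<sigma>y: "\<sigma> y = (if p y = b then a else p y)" if "y \<in> S" for y
  proof -
    have "p y \<in> S" using p that by (simp add: permutes_in_image)
    then show ?thesis using a by (auto simp: \<sigma>_def Transposition.transpose_def)
  qed
  have 1: "orbit \<sigma> x \<subseteq> insert a (orbit p x)" and in_a: "a \<in> orbit \<sigma> x \<Longrightarrow> b \<in> orbit p x"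
  proof -
    have "y \<in> orbit p x \<or> (y = a \<and> b \<in> orbit p x)" if "y \<in> orbit \<sigma> x" for y
      using that
    proof induction
      case base
      then show ?case using \<sigma>y[OF x] orbit.base[of p x] by auto
    next
      case (step y)
      show ?case
      proof (cases "y = a")
        case True
        with step \<sigma>a show ?thesis using a subS by auto
      next
        case False
        with step have y: "y \<in> orbit p x" by auto
        then have "y \<in> S" using subS by auto
        then show ?thesis using \<sigma>y[of y] orbit.step[OF y] by auto
      qed
    qed
    then show "orbit \<sigma> x \<subseteq> insert a (orbit p x)" "a \<in> orbit \<sigma> x \<Longrightarrow> b \<in> orbit p x"
      using a subS by auto
  qed
  have st: "p y \<in> orbit \<sigma> x" if y: "y = x \<or> y \<in> orbit \<sigma> x" "y \<in> S" for y
  proof -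
    have s: "\<sigma> y \<in> orbit \<sigma> x" using y(1) orbit.base[of \<sigma> x] orbit.step[of y \<sigma> x] by blast
    then have "\<sigma> (\<sigma> y) \<in> orbit \<sigma> x" by (rule orbit.step)
    then show ?thesis using s \<sigma>y[OF y(2)] \<sigma>a by (auto split: if_splits)
  qed
  have 2: "orbit p x \<subseteq> orbit \<sigma> x"
  proof
    fix y assume "y \<in> orbit p x"
    then show "y \<in> orbit \<sigma> x"
    proof induction
      case base
      then show ?case using st x by auto
    next
      case (step y)
      then show ?case using st[of y] subS by auto
    qed
  qed
  have 3: "a \<in> orbit \<sigma> x" if bb: "b \<in> orbit p x"
  proof -
    have b': "b \<in> orbit \<sigma> x" using bb 2 by auto
    then have "orbit \<sigma> b = orbit \<sigma> x"
      using orbit_eq_permutes[OF _ \<sigma>p, of b x] S by auto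
    moreover have "b \<in> orbit \<sigma> a"
      using \<sigma>a orbit.base[of \<sigma> a] by simp
    then have "orbit \<sigma> b = orbit \<sigma> a" using orbit_eq_permutes[OF _ \<sigma>p, of b a] S by auto
    moreover have "a \<in> orbit \<sigma> a" using self_in_orbit_permutes[OF _ \<sigma>p] S by auto
    ultimately show ?thesis by simp
  qed
  show ?thesis using 1 in_a 2 3 by auto
qed

lemma cycle_type_add_fixed_point:
  assumes S: "finite S" and p: "p permutes S" and a: "a \<notin> S"
  shows "cycle_type (insert a S) p = (cycle_type S p)(1 := Suc (cycle_type S p 1))"
proof
  fix j
  have pa: "p a = a" using p a by (simp add: permutes_not_in)
  then have oa: "orbit p a = {a}" by (simp add: orbit_eq_singleton_iff)
  have "{a} \<notin> orbit p ` S"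
    using permutes_orbit_subset[OF p] self_in_orbit_permutes[OF S p] a by blast
  moreover have "{c \<in> orbit p ` insert a S. card c = j}
      = (if j = 1 then insert {a} {c \<in> orbit p ` S. card c = j} else {c \<in> orbit p ` S. card c = j})"
    using oa by auto
  ultimately show "cycle_type (insert a S) p j = ((cycle_type S p)(1 := Suc (cycle_type S p 1))) j"
    using S by (auto simp: cycle_type_def)
qed

lemma cycle_type_insert_in_cycle:
  fixes p :: "'a \<Rightarrow> 'a"
  assumes S: "finite S" and p: "p permutes S" and a: "a \<notin> S" and b: "b \<in> S"
  defines "\<sigma> \<equiv> Transposition.transpose a b \<circ> p" and "l \<equiv> card (orbit p b)"
  shows "cycle_type (insert a S) \<sigma> =
     (cycle_type S p)(l := cycle_type S p l - 1, Suc l := Suc (cycle_type S p (Suc l)))"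
    and "cycle_type S p l > 0" and "l > 0"
proof -
  define B where "B = orbit p b"
  have \<sigma>p: "\<sigma> permutes insert a S"
    unfolding \<sigma>_def using p b 
    by (intro permutes_compose permutes_swap_id permutes_imp_permutes_insert) auto
  have pa: "p a = a" using p a by (simp add: permutes_not_in)
  have BS: "B \<subseteq> S" unfolding B_def using permutes_orbit_subset[OF p b] .
  have bB: "b \<in> B" unfolding B_def using self_in_orbit_permutes[OF S p] .
  have finB: "finite B" using BS S finite_subset by blast
  show "l > 0" unfolding l_def B_def[symmetric] using bB finB by (auto simp: card_gt_0_iff)
  have Bin: "B \<in> orbit p ` S" using b B_def by auto
  show "cycle_type S p l > 0"
    unfolding cycle_type_def using S Bin by (auto simp: card_gt_0_iff l_def B_def)
  have "b \<in> orbit \<sigma> a"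
    using orbit.base[of \<sigma> a] by (simp add: \<sigma>_def pa)
  then have oa: "orbit \<sigma> a = orbit \<sigma> b" 
    using orbit_eq_permutes[OF _ \<sigma>p, of b a] S by auto
  have ob: "orbit \<sigma> b = insert a B"
    using insert_in_cycle[OF S p a b b] bB by (auto simp: B_def \<sigma>_def)
  have eqB: "b \<in> orbit p x \<longleftrightarrow> orbit p x = B" for x
    unfolding B_def using orbit_eq_permutes[OF S p, of b x] self_in_orbit_permutes[OF S p] by auto
  have im: "orbit \<sigma> ` insert a S = insert (insert a B) (orbit p ` S - {B})"
  proof -
    have "orbit \<sigma> ` insert a S = insert (insert a B) (orbit \<sigma> ` S)" using oa ob by auto
    moreover have "orbit \<sigma> x = (if orbit p x = B then insert a B else orbit p x)" if "x \<in> S" for x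
      using insert_in_cycle[OF S p a b that] eqB[of x] by (auto simp: \<sigma>_def)
    then have "orbit \<sigma> ` S = (\<lambda>c. if c = B then insert a B else c) ` (orbit p ` S)"
      unfolding image_image by (intro image_cong) auto
    ultimately show ?thesis using Bin by auto
  qed
  have nin: "insert a B \<notin> orbit p ` S"
    using permutes_orbit_subset[OF p] a by blast
  have cB: "card B = l" "card (insert a B) = Suc l"
    using finB BS a by (simp_all add: l_def B_def[symmetric] card_insert_disjoint subset_iff) (metis card_insert_disjoint)
  have fin: "finite (orbit p ` S)" using S by auto
  show "cycle_type (insert a S) \<sigma> =
     (cycle_type S p)(l := cycle_type S p l - 1, Suc l := Suc (cycle_type S p (Suc l)))"
  proof
    fix j
    show "cycle_type (insert a S) \<sigma> j = 
      ((cycle_type S p)(l := cycle_type S p l - 1, Suc l := Suc (cycle_type S p (Suc l)))) j"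
    proof -
      consider "j = l" | "j = Suc l" | "j \<noteq> l" "j \<noteq> Suc l" by blast
      then show ?thesis
      proof cases
        case 1
        then have "{c \<in> orbit \<sigma> ` insert a S. card c = j} = {c \<in> orbit p ` S. card c = j} - {B}"
          unfolding im using cB by auto
        then show ?thesis using 1 Bin cB fin by (auto simp: cycle_type_def)
      next
        case 2
        then have "{c \<in> orbit \<sigma> ` insert a S. card c = j} = insert (insert a B) {c \<in> orbit p ` S. card c = j}"
          unfolding im using cB by auto
        then show ?thesis using 2 nin cB fin by (auto simp: cycle_type_def)
      next
        case 3
        then have "{c \<in> orbit \<sigma> ` insert a S. card c = j} = {c \<in> orbit p ` S. card c = j}"
          unfolding im using cB by auto
        then show ?thesis using 3 by (auto simp: cycle_type_def)
      qed
    qed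
  qed
qed

lemma card_elements_in_cycles_of_length:
  assumes S: "finite S" and p: "p permutes S"
  shows "card {b \<in> S. card (orbit p b) = j} = j * cycle_type S p j"
proof -
  have sub: "orbit p b \<subseteq> S" if "b \<in> S" for b
    using permutes_orbit_subset[OF p that] .
  have self: "b \<in> orbit p b" for b
    using self_in_orbit_permutes[OF S p] .
  have same: "orbit p x = orbit p y" if "x \<in> orbit p y" for x y
    using orbit_eq_permutes[OF S p that] .
  have "{b \<in> S. card (orbit p b) = j} = \<Union>{c \<in> orbit p ` S. card c = j}" (is "?L = ?R")
  proof
    show "?L \<subseteq> ?R" using self by blast
    show "?R \<subseteq> ?L"
    proof
      fix b assume "b \<in> ?R"
      then obtain y where y: "y \<in> S" "card (orbit p y) = j" "b \<in> orbit p y" by blast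
      then show "b \<in> ?L" using sub[of y] same[of b y] by auto
    qed
  qed
  moreover have "j * card {c \<in> orbit p ` S. card c = j} = card (\<Union>{c \<in> orbit p ` S. card c = j})"
  proof (rule card_partition)
    show "finite {c \<in> orbit p ` S. card c = j}" using S by simp
    show "finite (\<Union>{c \<in> orbit p ` S. card c = j})"
      by (rule finite_subset[OF _ S]) (use sub in blast)
    show "c1 \<inter> c2 = {}" if c: "c1 \<in> {c \<in> orbit p ` S. card c = j}"
      "c2 \<in> {c \<in> orbit p ` S. card c = j}" "c1 \<noteq> c2" for c1 c2
    proof -
      obtain x y where "c1 = orbit p x" "c2 = orbit p y" using c by blast
      then show ?thesis using c(3) same by blast
    qed
  qed simp
  ultimately show ?thesis by (simp add: cycle_type_def)
qed

section \<open>Cauchy's formula for the number of permutations of a given cycle type\<close>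

text \<open>Cauchy's formula says that this is the proportion of permutations with \<open>c j\<close> cycles of length \<open>j\<close> for
all \<open>j\<close>, provided that these lengths add up to the size of the ground set.\<close>

definition cauchy_weight :: "nat \<Rightarrow> (nat \<Rightarrow> nat) \<Rightarrow> real" where
  "cauchy_weight N c = (\<Prod>j\<in>{1..N}. 1 / (real j ^ c j * fact (c j)))"

lemma cauchy_weight_increment:
  assumes "i \<in> {1..N}"
  shows "cauchy_weight N (c(i := Suc (c i))) * (real i * real (Suc (c i))) = cauchy_weight N c"
proof -
  have *: "cauchy_weight N c = 1 / (real i ^ c i * fact (c i)) *
      (\<Prod>j\<in>{1..N}-{i}. 1 / (real j ^ c j * fact (c j)))" for c
    unfolding cauchy_weight_def using assms by (subst prod.remove[of _ i]) auto
  have rest: "(\<Prod>j\<in>{1..N}-{i}. 1 / (real j ^ (c(i := Suc (c i))) j * fact ((c(i := Suc (c i))) j)))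
     = (\<Prod>j\<in>{1..N}-{i}. 1 / (real j ^ c j * fact (c j)))"
    by (intro prod.cong) auto
  have factor: "1 / (real i ^ Suc (c i) * fact (Suc (c i))) * (real i * real (Suc (c i))) =
      1 / (real i ^ c i * fact (c i))"
  proof -
    have "real i ^ Suc (c i) * fact (Suc (c i)) = (real i ^ c i * fact (c i)) * (real i * real (Suc (c i)))"
      by (simp add: algebra_simps)
    moreover have "real i * real (Suc (c i)) \<noteq> 0" using assms by auto
    ultimately show ?thesis by (metis divide_divide_eq_left nonzero_eq_divide_eq)
  qed
  show ?thesis
    unfolding *[of c] *[of "c(i := Suc (c i))"] rest fun_upd_same factor[symmetric]
    by (simp only: mult_ac)
qed

lemma total_size_increment:
  assumes "i \<in> {1..N}"
  shows "(\<Sum>j=1..N. j * (c(i := Suc (c i))) j) = (\<Sum>j=1..N. j * c j) + i"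
proof -
  have *: "(\<Sum>j=1..N. j * c j) = i * c i + (\<Sum>j\<in>{1..N}-{i}. j * c j)" for c :: "nat \<Rightarrow> nat"
    using assms by (subst sum.remove[of _ i]) auto
  have "(\<Sum>j\<in>{1..N}-{i}. j * (c(i := Suc (c i))) j) = (\<Sum>j\<in>{1..N}-{i}. j * c j)"
    by (intro sum.cong) auto
  then show ?thesis unfolding *[of c] *[of "c(i := Suc (c i))"] by simp
qed

text \<open>Removing the point \<open>a\<close> either destroys a fixed point or shortens a cycle of length \<open>j + 1\<close> to
length \<open>j\<close>. In the second case the permutation that is left has \<open>c j + 1\<close> cycles of length \<open>j\<close>, so there are
\<open>j * (c j + 1)\<close> places where \<open>a\<close> can have been.\<close>

lemma count_cycle_type_insert:
  fixes c :: "nat \<Rightarrow> nat" and S :: "'a set"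
  assumes S: "finite S" and a: "a \<notin> S" and supp: "\<And>j. j \<notin> {1..N} \<Longrightarrow> c j = 0"
  defines "cnt \<equiv> \<lambda>S c. card {\<sigma> :: 'a \<Rightarrow> 'a. \<sigma> permutes S \<and> cycle_type S \<sigma> = c}"
  shows "cnt (insert a S) c =
    (if c 1 > 0 then cnt S (c(1 := c 1 - 1)) else 0) +
    (\<Sum>j\<in>{1..<N}. if c (Suc j) > 0 then
         j * Suc (c j) * cnt S (c(j := Suc (c j), Suc j := c (Suc j) - 1)) else 0)"
proof -
  define Pm where "Pm = {p. p permutes S}"
  define f where "f = (\<lambda>(b :: 'a, p :: 'a \<Rightarrow> 'a). Transposition.transpose a b \<circ> p)"
  have finP: "finite Pm" unfolding Pm_def using S by (rule finite_permutations)
  define E where "E = {bp \<in> {a} \<times> Pm. cycle_type (insert a S) (f bp) = c}"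
  define D where "D = (\<lambda>j. {(b, p) \<in> S \<times> Pm. card (orbit p b) = j \<and> cycle_type (insert a S) (f (b, p)) = c})"
  have inj: "inj_on f (insert a S \<times> Pm)"
  proof (rule inj_onI, clarify)
    fix b p b' p' assume bp: "b \<in> insert a S" "p \<in> Pm" "b' \<in> insert a S" "p' \<in> Pm"
      and eq: "f (b, p) = f (b', p')"
    have "p a = a" "p' a = a" using bp a by (auto simp: Pm_def permutes_not_in)
    then have "b = f (b, p) a" "b' = f (b', p') a" by (auto simp: f_def)
    then have b: "b = b'" using eq by simp
    have "Transposition.transpose a b \<circ> (Transposition.transpose a b \<circ> p) =
          Transposition.transpose a b \<circ> (Transposition.transpose a b \<circ> p')"
      using eq b by (simp add: f_def)
    then have "p = p'" by (simp add: o_assoc[symmetric] fun_eq_iff)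
    then show "b = b' \<and> p = p'" using b by simp
  qed
  have decomp: "{\<sigma>. \<sigma> permutes insert a S \<and> cycle_type (insert a S) \<sigma> = c} = f ` (E \<union> (\<Union>j\<in>{1..<N}. D j))"
  proof -
    have bd: "card (orbit p b) \<in> {1..<N}" if bp: "b \<in> S" "p \<in> Pm" "cycle_type (insert a S) (f (b, p)) = c" for b p
    proof -
      let ?l = "card (orbit p b)"
      note * = cycle_type_insert_in_cycle[OF S _ a bp(1), of p]
      have p: "p permutes S" using bp by (simp add: Pm_def)
      have "c = (cycle_type S p)(?l := cycle_type S p ?l - 1, Suc ?l := Suc (cycle_type S p (Suc ?l)))"
        using *(1)[OF p] bp(3) by (simp add: f_def)
      then have "c (Suc ?l) = Suc (cycle_type S p (Suc ?l))" by (metis fun_upd_same)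
      then have "c (Suc ?l) > 0" by simp
      then have "Suc ?l \<in> {1..N}" using supp[of "Suc ?l"] by (cases "Suc ?l \<in> {1..N}") auto
      then show ?thesis using *(3)[OF p] by auto
    qed
    have "{\<sigma>. \<sigma> permutes insert a S \<and> cycle_type (insert a S) \<sigma> = c}
        = {\<sigma> \<in> f ` (insert a S \<times> Pm). cycle_type (insert a S) \<sigma> = c}"
      using permutes_insert[of a S] unfolding f_def Pm_def
      by (intro Collect_cong conj_cong refl) (auto simp: Sigma_def set_eq_iff)
    also have "\<dots> = f ` {bp \<in> insert a S \<times> Pm. cycle_type (insert a S) (f bp) = c}"
      by auto
    also have "{bp \<in> insert a S \<times> Pm. cycle_type (insert a S) (f bp) = c} = E \<union> (\<Union>j\<in>{1..<N}. D j)"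
      unfolding E_def D_def using bd by fastforce
    finally show ?thesis .
  qed
  have sub: "E \<union> (\<Union>j\<in>{1..<N}. D j) \<subseteq> insert a S \<times> Pm"
    unfolding E_def D_def by auto
  have finE: "finite E" and finD: "finite (D j)" for j
  proof -
    show "finite E" unfolding E_def using finP by auto
    have "D j \<subseteq> S \<times> Pm" unfolding D_def by auto
    then show "finite (D j)" using S finP finite_subset by blast
  qed
  have "cnt (insert a S) c = card (f ` (E \<union> (\<Union>j\<in>{1..<N}. D j)))"
    unfolding cnt_def decomp ..
  also have "\<dots> = card (E \<union> (\<Union>j\<in>{1..<N}. D j))"
    using inj sub by (intro card_image) (rule inj_on_subset)
  also have "\<dots> = card E + card (\<Union>j\<in>{1..<N}. D j)"
    using a finE finD by (intro card_Un_disjoint) (auto simp: E_def D_def)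
  also have "card (\<Union>j\<in>{1..<N}. D j) = (\<Sum>j\<in>{1..<N}. card (D j))"
    using finD by (intro card_UN_disjoint) (auto simp: D_def)
  also have "card E = (if c 1 > 0 then cnt S (c(1 := c 1 - 1)) else 0)"
  proof -
    have ft: "f (a, p) = p" for p by (auto simp: f_def)
    have "E = Pair a ` {p \<in> Pm. cycle_type (insert a S) p = c}"
      unfolding E_def using ft by auto
    also have "{p \<in> Pm. cycle_type (insert a S) p = c} =
       {p \<in> Pm. c 1 > 0 \<and> cycle_type S p = c(1 := c 1 - 1)}"
      using cycle_type_add_fixed_point[OF S _ a] by (auto simp: Pm_def)
    finally have "card E = card {p \<in> Pm. c 1 > 0 \<and> cycle_type S p = c(1 := c 1 - 1)}"
      by (simp add: card_image inj_on_def)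
    then show ?thesis by (auto simp: cnt_def Pm_def)
  qed
  also have "(\<Sum>j\<in>{1..<N}. card (D j)) = (\<Sum>j\<in>{1..<N}. if c (Suc j) > 0 then
         j * Suc (c j) * cnt S (c(j := Suc (c j), Suc j := c (Suc j) - 1)) else 0)"
  proof (intro sum.cong refl)
    fix j assume j: "j \<in> {1..<N}"
    let ?c' = "c(j := Suc (c j), Suc j := c (Suc j) - 1)"
    have iff: "cycle_type (insert a S) (f (b, p)) = c \<longleftrightarrow> c (Suc j) > 0 \<and> cycle_type S p = ?c'"
      if "b \<in> S" "p \<in> Pm" "card (orbit p b) = j" for b p
    proof -
      have p: "p permutes S" using that by (simp add: Pm_def)
      note * = cycle_type_insert_in_cycle[OF S p a that(1)]
      have 1: "cycle_type (insert a S) (f (b, p)) = 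
        (cycle_type S p)(j := cycle_type S p j - 1, Suc j := Suc (cycle_type S p (Suc j)))"
        and 2: "cycle_type S p j > 0"
        using * that(3) by (auto simp: f_def)
      show ?thesis unfolding 1 using 2 by (auto simp: fun_eq_iff)
    qed
    have "D j = {(b, p). p \<in> {p \<in> Pm. c (Suc j) > 0 \<and> cycle_type S p = ?c'} \<and> b \<in> {b \<in> S. card (orbit p b) = j}}"
      unfolding D_def using iff by auto
    also have "\<dots> = (\<lambda>(p, b). (b, p)) ` (SIGMA p:{p \<in> Pm. c (Suc j) > 0 \<and> cycle_type S p = ?c'}. {b \<in> S. card (orbit p b) = j})"
      by auto
    finally have "card (D j) = card (SIGMA p:{p \<in> Pm. c (Suc j) > 0 \<and> cycle_type S p = ?c'}. {b \<in> S. card (orbit p b) = j})"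
      by (simp add: card_image inj_on_def)
    also have "\<dots> = (\<Sum>p\<in>{p \<in> Pm. c (Suc j) > 0 \<and> cycle_type S p = ?c'}. card {b \<in> S. card (orbit p b) = j})"
      using finP S by (subst card_SigmaI) auto
    also have "\<dots> = (\<Sum>p\<in>{p \<in> Pm. c (Suc j) > 0 \<and> cycle_type S p = ?c'}. j * Suc (c j))"
    proof (intro sum.cong refl)
      fix p assume p: "p \<in> {p \<in> Pm. c (Suc j) > 0 \<and> cycle_type S p = ?c'}"
      then have "card {b \<in> S. card (orbit p b) = j} = j * cycle_type S p j"
        by (intro card_elements_in_cycles_of_length[OF S]) (simp add: Pm_def)
      then show "card {b \<in> S. card (orbit p b) = j} = j * Suc (c j)" using p by simp
    qed
    finally show "card (D j) = (if c (Suc j) > 0 then j * Suc (c j) * cnt S ?c' else 0)"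
      by (auto simp: cnt_def Pm_def)
  qed
  finally show ?thesis .
qed

text \<open>Cauchy's formula. In the recursion above, the summands are, up to the common factor
\<open>fact (card S) * cauchy_weight N c\<close>, the numbers \<open>1 * c 1\<close> and \<open>(j + 1) * c (j + 1)\<close>; they add up to the size
of the enlarged ground set. Including the case of vectors \<open>c\<close> with the wrong total makes the induction
self-contained: that the cycle lengths of a permutation add up to the size of the set is then a
consequence and not a prerequisite.\<close>

lemma count_cycle_type:
  fixes S :: "'a set"
  assumes "finite S" and "\<And>j. j \<notin> {1..N} \<Longrightarrow> c j = 0"
  shows "real (card {\<sigma>. \<sigma> permutes S \<and> cycle_type S \<sigma> = c}) =
    (if (\<Sum>j=1..N. j * c j) = card S then fact (card S) * cauchy_weight N c else 0)"
  using assms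
proof (induction S arbitrary: c rule: finite_induct)
  case empty
  have 1: "cycle_type {} \<sigma> = (\<lambda>_. 0)" for \<sigma> :: "'a \<Rightarrow> 'a" by (auto simp: cycle_type_def)
  show ?case
  proof (cases "(\<Sum>j=1..N. j * c j) = 0")
    case True
    then have "c j = 0" for j using empty[of j] by (cases "j \<in> {1..N}") auto
    then have c: "c = (\<lambda>_. 0)" by auto
    then show ?thesis using 1 by (simp add: cauchy_weight_def)
  next
    case False
    then have "c \<noteq> (\<lambda>_. 0)" by auto
    then show ?thesis using 1 False by auto
  qed
next
  case (insert a S)
  let ?cnt = "\<lambda>c. card {\<sigma> :: 'a \<Rightarrow> 'a. \<sigma> permutes S \<and> cycle_type S \<sigma> = c}"
  let ?W = "\<lambda>c. \<Sum>j=1..N. j * c j :: nat"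
  let ?w = "cauchy_weight N"
  define n where "n = card S"
  \<comment> \<open>the common factor of all summands of the recursion\<close>
  define good where "good = (if ?W c = Suc n then fact n * ?w c else 0 :: real)"
  have supp: "c j = 0" if "j \<notin> {1..N}" for j using insert.prems that by auto
  have t1: "real (if c 1 > 0 then ?cnt (c(1 := c 1 - 1)) else 0) = real (c 1) * good"
  proof (cases "c 1 > 0")
    case True
    define d where "d = c(1 := c 1 - 1)"
    have N: "1 \<in> {1..N}" using supp[of 1] True by (cases "1 \<in> {1..N}") auto
    have c: "c = d(1 := Suc (d 1))" unfolding d_def using True by auto
    have IH: "real (?cnt d) = (if ?W d = n then fact n * ?w d else 0)"
      unfolding n_def using supp N by (intro insert.IH) (auto simp: d_def)
    have W: "?W c = ?W d + 1" by (subst c, rule total_size_increment[OF N])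
    have "?w c * (real 1 * real (Suc (d 1))) = ?w d"
      by (subst c, rule cauchy_weight_increment[OF N])
    then have "?w d = real (c 1) * ?w c" using c by (metis fun_upd_same mult.commute mult_1 of_nat_1)
    then show ?thesis using IH W True unfolding good_def d_def by simp
  qed simp
  have t2: "real (if c (Suc j) > 0 then j * Suc (c j) * ?cnt (c(j := Suc (c j), Suc j := c (Suc j) - 1)) else 0)
     = real (Suc j * c (Suc j)) * good" if j: "j \<in> {1..<N}" for j
  proof (cases "c (Suc j) > 0")
    case True
    define d where "d = c(Suc j := c (Suc j) - 1)"
    define e where "e = d(j := Suc (d j))"
    have N: "Suc j \<in> {1..N}" "j \<in> {1..N}" using j by auto
    have e: "c(j := Suc (c j), Suc j := c (Suc j) - 1) = e" unfolding e_def d_def by auto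
    have c: "c = d(Suc j := Suc (d (Suc j)))" unfolding d_def using True by auto
    have dj: "d j = c j" by (simp add: d_def)
    have IH: "real (?cnt e) = (if ?W e = n then fact n * ?w e else 0)"
      unfolding n_def using supp N by (intro insert.IH) (auto simp: d_def e_def)
    have "?W c = ?W d + Suc j" by (subst c, rule total_size_increment[OF N(1)])
    moreover have "?W e = ?W d + j" unfolding e_def by (rule total_size_increment[OF N(2)])
    ultimately have W: "?W c = Suc (?W e)" by simp
    have "?w c * (real (Suc j) * real (Suc (d (Suc j)))) = ?w d"
      by (subst c, rule cauchy_weight_increment[OF N(1)])
    moreover have "Suc (d (Suc j)) = c (Suc j)" using True by (simp add: d_def)
    moreover have "?w e * (real j * real (Suc (c j))) = ?w d"
      unfolding e_def dj[symmetric] by (rule cauchy_weight_increment[OF N(2)])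
    ultimately have we: "real j * real (Suc (c j)) * ?w e = real (Suc j) * real (c (Suc j)) * ?w c"
      by (simp only: mult_ac)
    have "real (j * Suc (c j) * ?cnt e) = (if ?W e = n then fact n * (real j * real (Suc (c j)) * ?w e) else 0)"
      unfolding of_nat_mult IH by simp
    also have "\<dots> = real (Suc j * c (Suc j)) * good"
      unfolding we good_def W of_nat_mult by (simp only: mult_ac if_distrib mult_zero_right cong: if_cong) auto
    finally show ?thesis unfolding e using True by simp
  qed simp
  have "real (card {\<sigma>. \<sigma> permutes insert a S \<and> cycle_type (insert a S) \<sigma> = c}) =
     real (if c 1 > 0 then ?cnt (c(1 := c 1 - 1)) else 0) +
     (\<Sum>j\<in>{1..<N}. real (if c (Suc j) > 0 then
         j * Suc (c j) * ?cnt (c(j := Suc (c j), Suc j := c (Suc j) - 1)) else 0))"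
    unfolding of_nat_sum[symmetric] of_nat_add[symmetric] of_nat_eq_iff
    by (rule count_cycle_type_insert[OF insert.hyps(1,2)]) (use supp in auto)
  also have "\<dots> = real (c 1) * good + (\<Sum>j\<in>{1..<N}. real (Suc j * c (Suc j)) * good)"
    unfolding t1 using t2 by (intro arg_cong2[where f="(+)"] sum.cong) auto
  also have "\<dots> = real (c 1 + (\<Sum>j\<in>{1..<N}. Suc j * c (Suc j))) * good"
    by (simp add: sum_distrib_right ring_distribs)
  also have "c 1 + (\<Sum>j\<in>{1..<N}. Suc j * c (Suc j)) = ?W c"
  proof (cases "N = 0")
    case True
    then show ?thesis using supp[of 1] by simp
  next
    case False
    have "?W c = 1 * c 1 + (\<Sum>j\<in>{Suc 1..N}. j * c j)"
      using False by (subst sum.atLeast_Suc_atMost) auto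
    also have "(\<Sum>j\<in>{Suc 1..N}. j * c j) = (\<Sum>j\<in>{1..<N}. Suc j * c (Suc j))"
      using False by (intro sum.reindex_bij_witness[of _ Suc "\<lambda>j. j - 1"]) auto
    finally show ?thesis by simp
  qed
  finally have "real (card {\<sigma>. \<sigma> permutes insert a S \<and> cycle_type (insert a S) \<sigma> = c}) = real (?W c) * good" .
  also have "\<dots> = (if ?W c = Suc n then fact (Suc n) * ?w c else 0)"
    by (simp add: good_def del: of_nat_sum of_nat_mult)
  finally show ?case using insert.hyps by (simp add: n_def)
qed

section \<open>Characteristic functions and Fourier inversion for discrete laws\<close>

lemma integrable_measure_pmf_bounded:
  fixes f :: "'a \<Rightarrow> 'b :: {banach, second_countable_topology}"
  assumes "\<And>x. norm (f x) \<le> B"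
  shows "integrable (measure_pmf p) f"
  by (rule measure_pmf.integrable_const_bound[of _ B]) (use assms in auto)

lemma expectation_poisson_cis:
  assumes r: "0 < r"
  shows "measure_pmf.expectation (poisson_pmf r) (\<lambda>k. cis (t * real k)) = exp (of_real r * (cis t - 1))"
proof -
  have int: "integrable (count_space UNIV) (\<lambda>k. pmf (poisson_pmf r) k *\<^sub>R cis (t * real k))"
  proof -
    have "integrable (measure_pmf (poisson_pmf r)) (\<lambda>k. cis (t * real k))"
      by (rule integrable_measure_pmf_bounded[of _ 1]) simp
    then show ?thesis
      by (subst (asm) measure_pmf_eq_density, subst (asm) integrable_density) auto
  qed
  have "measure_pmf.expectation (poisson_pmf r) (\<lambda>k. cis (t * real k)) =
      (\<integral>k. pmf (poisson_pmf r) k *\<^sub>R cis (t * real k) \<partial>count_space UNIV)"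
    by (subst measure_pmf_eq_density, subst integral_density) auto
  also have "\<dots> = (\<Sum>k. pmf (poisson_pmf r) k *\<^sub>R cis (t * real k))"
    using int by (rule integral_count_space_nat)
  also have "\<dots> = (\<Sum>k. ((of_real r * cis t) ^ k /\<^sub>R fact k) * of_real (exp (-r)))"
    using r by (intro suminf_cong) 
      (simp add: power_mult_distrib Complex.DeMoivre scaleR_conv_of_real field_simps)
  also have "\<dots> = (\<Sum>k. (of_real r * cis t) ^ k /\<^sub>R fact k) * of_real (exp (-r))"
    by (rule suminf_mult2[symmetric]) (rule summable_exp_generic)
  also have "(\<Sum>k. (of_real r * cis t) ^ k /\<^sub>R fact k) = exp (of_real r * cis t)"
    by (simp add: exp_def)
  also have "exp (of_real r * cis t) * of_real (exp (-r)) = exp (of_real r * (cis t - 1))"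
    unfolding exp_of_real[symmetric] exp_add[symmetric] by (simp add: algebra_simps)
  finally show ?thesis .
qed

text \<open>Functions of disjoint sets of coordinates are independent. The functions factor through finitely
many coordinates with values in a countable set, where measurability is no restriction.\<close>

lemma expectation_Pi_pmf_mult_indep:
  fixes F G :: "('i \<Rightarrow> nat) \<Rightarrow> complex"
  assumes J: "finite J" and M: "M1 \<subseteq> J" "M2 \<subseteq> J" "M1 \<inter> M2 = {}"
    and F: "\<And>c c'. (\<And>j. j \<in> M1 \<Longrightarrow> c j = c' j) \<Longrightarrow> F c = F c'" "\<And>c. norm (F c) \<le> B1"
    and G: "\<And>c c'. (\<And>j. j \<in> M2 \<Longrightarrow> c j = c' j) \<Longrightarrow> G c = G c'" "\<And>c. norm (G c) \<le> B2"
  shows "measure_pmf.expectation (Pi_pmf J d p) (\<lambda>c. F c * G c) =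
     measure_pmf.expectation (Pi_pmf J d p) F * measure_pmf.expectation (Pi_pmf J d p) G"
proof -
  let ?P = "measure_pmf (Pi_pmf J d p)"
  let ?PM = "\<lambda>K. PiM K (\<lambda>_. count_space (UNIV :: nat set)) :: ('i \<Rightarrow> nat) measure"
  have fin: "finite M1" "finite M2" using J M finite_subset by blast+
  have cs: "?PM K = count_space (PiE K (\<lambda>_. UNIV))" if "finite K" for K
    using that by (intro count_space_PiM_finite) auto
  have "prob_space.indep_var ?P (?PM M1) (\<lambda>c. restrict (\<lambda>i. c i) M1) (?PM M2) (\<lambda>c. restrict (\<lambda>i. c i) M2)"
    using indep_vars_Pi_pmf[OF J, of d p] M by (intro prob_space.indep_var_restrict[OF measure_pmf.prob_space_axioms]) auto
  then have "prob_space.indep_var ?P borel (F \<circ> (\<lambda>c. restrict (\<lambda>i. c i) M1)) borel (G \<circ> (\<lambda>c. restrict (\<lambda>i. c i) M2))"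
    by (rule prob_space.indep_var_compose[OF measure_pmf.prob_space_axioms]) (auto simp: cs fin)
  moreover have "F \<circ> (\<lambda>c. restrict (\<lambda>i. c i) M1) = F" "G \<circ> (\<lambda>c. restrict (\<lambda>i. c i) M2) = G"
    unfolding fun_eq_iff o_apply by (intro allI F(1) G(1); simp)+
  ultimately have "prob_space.indep_var ?P borel F borel G" by simp
  then show ?thesis
    using F(2) G(2) by (intro prob_space.indep_var_lebesgue_integral[OF measure_pmf.prob_space_axioms] integrable_measure_pmf_bounded)
qed

lemma expectation_Pi_pmf_prod:
  fixes f :: "'i \<Rightarrow> nat \<Rightarrow> complex"
  assumes J: "finite J" and M: "M \<subseteq> J" and f: "\<And>j k. norm (f j k) \<le> 1"
  shows "measure_pmf.expectation (Pi_pmf J d p) (\<lambda>c. \<Prod>j\<in>M. f j (c j)) =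
     (\<Prod>j\<in>M. measure_pmf.expectation (p j) (f j))"
proof -
  have "finite M" using J M finite_subset by blast
  then show ?thesis using M
  proof (induction M rule: finite_induct)
    case (insert a M)
    have "measure_pmf.expectation (Pi_pmf J d p) (\<lambda>c. \<Prod>j\<in>insert a M. f j (c j)) =
      measure_pmf.expectation (Pi_pmf J d p) (\<lambda>c. f a (c a) * (\<Prod>j\<in>M. f j (c j)))"
      using insert by simp
    also have "\<dots> = measure_pmf.expectation (Pi_pmf J d p) (\<lambda>c. f a (c a)) *
        measure_pmf.expectation (Pi_pmf J d p) (\<lambda>c. \<Prod>j\<in>M. f j (c j))"
    proof (rule expectation_Pi_pmf_mult_indep[OF J, of "{a}" M _ 1 _ 1])
      show "norm (\<Prod>j\<in>M. f j (c j)) \<le> 1" for c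
        unfolding prod_norm[symmetric] using f by (intro prod_le_1) auto
    qed (use insert f in \<open>auto intro: prod.cong\<close>)
    also have "measure_pmf.expectation (Pi_pmf J d p) (\<lambda>c. f a (c a)) =
        measure_pmf.expectation (map_pmf (\<lambda>c. c a) (Pi_pmf J d p)) (f a)"
      by (simp add: integral_map_pmf)
    also have "map_pmf (\<lambda>c. c a) (Pi_pmf J d p) = p a"
      using insert J by (subst Pi_pmf_component) auto
    finally show ?case using insert by simp
  qed simp
qed

text \<open>The mean deviation is at most the standard deviation, whose square is \<open>E|Z|\<^sup>2 - |EZ|\<^sup>2\<close>.\<close>

lemma expectation_deviation_unit_circle:
  fixes Z :: "'a \<Rightarrow> complex" and p :: "'a pmf"
  assumes Z: "\<And>x. norm (Z x) = 1"
  defines "\<phi> \<equiv> measure_pmf.expectation p Z"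
  shows "measure_pmf.expectation p (\<lambda>x. norm (Z x - \<phi>)) \<le> sqrt (1 - (norm \<phi>)\<^sup>2)"
proof -
  have i1: "integrable p Z" by (rule integrable_measure_pmf_bounded[of _ 1]) (simp add: Z)
  have b: "norm (Z x - \<phi>) \<le> 1 + norm \<phi>" for x
    using norm_triangle_ineq4[of "Z x" \<phi>] Z[of x] by simp
  have i2: "integrable p (\<lambda>x. norm (Z x - \<phi>))"
    by (rule integrable_measure_pmf_bounded[of _ "1 + norm \<phi>"]) (simp add: b)
  have i3: "integrable p (\<lambda>x. (norm (Z x - \<phi>))\<^sup>2)"
    by (rule integrable_measure_pmf_bounded[of _ "(1 + norm \<phi>)\<^sup>2"]) (simp add: b power_mono)
  have "(measure_pmf.expectation p (\<lambda>x. norm (Z x - \<phi>)))\<^sup>2 \<le> measure_pmf.expectation p (\<lambda>x. (norm (Z x - \<phi>))\<^sup>2)"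
    using measure_pmf.variance_positive[of p "\<lambda>x. norm (Z x - \<phi>)"] measure_pmf.variance_eq[OF i2 i3] by simp
  also have "(\<lambda>x. (norm (Z x - \<phi>))\<^sup>2) = (\<lambda>x. 1 + (norm \<phi>)\<^sup>2 - 2 * Re (Z x * cnj \<phi>))"
  proof
    fix x
    have "(norm (Z x - \<phi>))\<^sup>2 = (norm (Z x))\<^sup>2 + (norm \<phi>)\<^sup>2 - 2 * Re (Z x * cnj \<phi>)"
      unfolding cmod_power2 by (simp add: power2_eq_square algebra_simps)
    then show "(norm (Z x - \<phi>))\<^sup>2 = 1 + (norm \<phi>)\<^sup>2 - 2 * Re (Z x * cnj \<phi>)" by (simp add: Z)
  qed
  also have "measure_pmf.expectation p \<dots> = 1 + (norm \<phi>)\<^sup>2 - 2 * Re (measure_pmf.expectation p (\<lambda>x. Z x * cnj \<phi>))"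
    using i1 by (simp add: integral_Re)
  also have "measure_pmf.expectation p (\<lambda>x. Z x * cnj \<phi>) = \<phi> * cnj \<phi>"
    unfolding \<phi>_def by simp
  also have "Re (\<phi> * cnj \<phi>) = (norm \<phi>)\<^sup>2"
    unfolding complex_mult_cnj cmod_power2 by simp
  finally have "(measure_pmf.expectation p (\<lambda>x. norm (Z x - \<phi>)))\<^sup>2 \<le> 1 - (norm \<phi>)\<^sup>2" by simp
  then show ?thesis by (rule real_le_rsqrt)
qed

lemma integral_cis_int:
  fixes k :: int
  shows "(LINT t|restrict_space lborel {-pi..pi}. cis (t * of_int k)) = (if k = 0 then of_real (2 * pi) else 0)"
proof -
  have eq: "(LINT t|restrict_space lborel {-pi..pi}. cis (t * of_int k)) = (LINT t|lborel. indicator {-pi..pi} t *\<^sub>R cis (t * of_int k))"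
    by (subst integral_restrict_space) auto
  show ?thesis
  proof (cases "k = 0")
    case True
    then show ?thesis unfolding eq by (simp add: cis_zero scaleR_conv_of_real)
  next
    case False
    let ?F = "\<lambda>t :: real. cis (t * of_int k) / (\<i> * of_int k)"
    have "(LINT t|lborel. indicator {-pi..pi} t *\<^sub>R cis (t * of_int k)) = ?F pi - ?F (-pi)"
    proof (rule integral_FTC_Icc)
      show "(?F has_vector_derivative cis (t * of_int k)) (at t within {-pi..pi})" for t
      proof -
        have "((\<lambda>z. exp (\<i> * (z * of_int k)) / (\<i> * of_int k)) has_field_derivative
            exp (\<i> * (of_real t * of_int k))) (at (of_real t))"
          using False by (auto intro!: derivative_eq_intros simp: mult.commute[of _ \<i>])
        from has_vector_derivative_real_field[OF this] show ?thesis
          by (simp add: cis_conv_exp)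
      qed
    qed (auto intro!: continuous_intros)
    also have "?F pi = ?F (-pi)"
    proof -
      have "cis (pi * of_int k) = cis (- pi * of_int k) * cis (2 * pi * of_int k)"
        by (simp add: cis_mult algebra_simps)
      also have "cis (2 * pi * of_int k) = 1" by (intro cis_multiple_2pi) auto
      finally show ?thesis by simp
    qed
    finally show ?thesis using False unfolding eq by simp
  qed
qed

lemma finite_measure_restrict_Icc: "finite_measure (restrict_space lborel {a..b::real})"
  by (rule finite_measureI) (auto simp: emeasure_restrict_space space_restrict_space emeasure_lborel_Icc_eq)

lemma measurable_cis [measurable]: "cis \<in> borel_measurable borel"
  by (intro borel_measurable_continuous_onI continuous_intros)

text \<open>Integrating \<open>cis (t * k)\<close> over a full period picks out \<open>k = 0\<close>; Fubini's theorem exchanges this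
integral with the expectation.\<close>

lemma fourier_inversion_pmf:
  fixes T :: "'a \<Rightarrow> nat" and F :: "'a \<Rightarrow> complex"
  assumes F: "\<And>x. norm (F x) \<le> B"
  shows "measure_pmf.expectation p (\<lambda>x. F x * of_bool (T x = n)) = 
    1 / of_real (2 * pi) * (LINT t|restrict_space lborel {-pi..pi}.
       measure_pmf.expectation p (\<lambda>x. F x * cis (t * (real (T x) - real n))))"
proof -
  let ?L = "restrict_space lborel {-pi..pi} :: real measure"
  let ?f = "\<lambda>t x. F x * cis (t * (real (T x) - real n))"
  interpret L: finite_measure ?L by (rule finite_measure_restrict_Icc)
  interpret pair_sigma_finite ?L "measure_pmf p" ..
  interpret pair_finite: finite_measure "?L \<Otimes>\<^sub>M measure_pmf p"
    by (intro finite_measure_pair_measure) unfold_locales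
  have [measurable]: "(\<lambda>t. t) \<in> borel_measurable ?L"
    by (intro measurable_restrict_space1) simp
  have int: "integrable (?L \<Otimes>\<^sub>M measure_pmf p) (\<lambda>(t, x). ?f t x)"
  proof (rule pair_finite.integrable_const_bound[of _ B])
    have [measurable]: "fst \<in> borel_measurable (?L \<Otimes>\<^sub>M measure_pmf p)"
      using measurable_compose[OF measurable_fst \<open>(\<lambda>t. t) \<in> borel_measurable ?L\<close>] by simp
    have [measurable]: "(\<lambda>z. F (snd z)) \<in> borel_measurable (?L \<Otimes>\<^sub>M measure_pmf p)"
       "(\<lambda>z. real (T (snd z)) - real n) \<in> borel_measurable (?L \<Otimes>\<^sub>M measure_pmf p)"
      by (rule measurable_compose[OF measurable_snd], simp)+
    show "(\<lambda>(t, x). ?f t x) \<in> borel_measurable (?L \<Otimes>\<^sub>M measure_pmf p)"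
      unfolding case_prod_unfold by measurable
  qed (auto simp: norm_mult F)
  have "(LINT t|?L. measure_pmf.expectation p (?f t)) = (LINT x|measure_pmf p. (LINT t|?L. ?f t x))"
    using Fubini_integral[OF int] by simp
  also have "(\<lambda>x. LINT t|?L. ?f t x) = (\<lambda>x. of_real (2 * pi) * (F x * of_bool (T x = n)))"
  proof
    fix x
    have "(LINT t|?L. ?f t x) = F x * (LINT t|?L. cis (t * of_int (int (T x) - int n)))"
      by simp
    then show "(LINT t|?L. ?f t x) = of_real (2 * pi) * (F x * of_bool (T x = n))"
      unfolding integral_cis_int by auto
  qed
  finally show ?thesis by simp
qed

section \<open>Elementary analytic estimates\<close>

lemma one_minus_cos_le: "1 - cos y \<le> y\<^sup>2 / 2" for y :: real
proof -
  have "\<bar>sin (y/2)\<bar> \<le> \<bar>y/2\<bar>" by (rule abs_sin_x_le_abs_x)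
  then have "(sin (y/2))\<^sup>2 \<le> (y/2)\<^sup>2" by (rule abs_le_square_iff[THEN iffD1])
  moreover have "cos y = 1 - 2 * (sin (y/2))\<^sup>2"
    using cos_double_sin[of "y/2"] by simp
  ultimately show ?thesis by (simp add: power_divide)
qed

lemma one_minus_cos_ge:
  fixes y :: real
  assumes "\<bar>y\<bar> \<le> 1"
  shows "y\<^sup>2 / 4 \<le> 1 - cos y"
proof -
  have "cmod (iexp y - (\<Sum>k\<le>3. (\<i> * y) ^ k / fact k)) \<le> \<bar>y\<bar> ^ 4 / fact 4"
    using iexp_approx1[of y 3] by simp
  then have "\<bar>Re (iexp y - (\<Sum>k\<le>3. (\<i> * y) ^ k / fact k))\<bar> \<le> \<bar>y\<bar> ^ 4 / fact 4"
    using abs_Re_le_cmod order_trans by blast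
  also have "Re (iexp y - (\<Sum>k\<le>3. (\<i> * y) ^ k / fact k)) = cos y - 1 + y\<^sup>2 / 2"
    by (simp add: eval_nat_numeral exp_Euler cos_of_real sin_of_real)
  also have "\<bar>y\<bar> ^ 4 / fact 4 \<le> y\<^sup>2 / 24"
  proof -
    have "y\<^sup>2 \<le> 1" using assms by (simp add: abs_square_le_1)
    then have "y\<^sup>2 * y\<^sup>2 \<le> y\<^sup>2 * 1" by (intro mult_left_mono) auto
    then show ?thesis by (simp add: fact_numeral eval_nat_numeral)
  qed
  finally have "\<bar>cos y - 1 + y\<^sup>2 / 2\<bar> \<le> y\<^sup>2 / 24" .
  then show ?thesis using zero_le_power2[of y] unfolding abs_le_iff by linarith
qed

lemma cis_minus_linear_bound: "cmod (cis y - 1 - \<i> * complex_of_real y + (complex_of_real y)\<^sup>2 / 2) \<le> \<bar>y\<bar> ^ 3 / 6"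
proof -
  have "cmod (iexp y - (\<Sum>k\<le>2. (\<i> * y) ^ k / fact k)) \<le> \<bar>y\<bar> ^ 3 / fact 3"
    using iexp_approx1[of y 2] by simp
  moreover have "iexp y - (\<Sum>k\<le>2. (\<i> * y) ^ k / fact k) = cis y - 1 - \<i> * complex_of_real y + (complex_of_real y)\<^sup>2 / 2"
    by (simp add: eval_nat_numeral cis_conv_exp algebra_simps)
  ultimately show ?thesis by (simp add: fact_numeral)
qed

text \<open>On the left half-plane \<open>exp\<close> has derivative of modulus at most 1, and the half-plane is convex.\<close>

lemma norm_exp_diff_le:
  fixes u v :: complex
  assumes "Re u \<le> 0" "Re v \<le> 0"
  shows "norm (exp u - exp v) \<le> norm (u - v)"
proof -
  have "norm (exp u - exp v) \<le> 1 * norm (u - v)"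
  proof (rule field_differentiable_bound[of "{z. Re z \<le> 0}" exp exp])
    show "convex {z. Re z \<le> 0}" by (rule convex_halfspace_Re_le)
  qed (use assms in \<open>auto intro!: derivative_eq_intros\<close>)
  then show ?thesis by simp
qed

abbreviation "unit_circle_measure \<equiv> restrict_space lborel {-pi..pi::real}"

lemma integrable_circle:
  fixes f :: "real \<Rightarrow> 'b :: {banach, second_countable_topology}"
  assumes "continuous_on UNIV f"
  shows "integrable unit_circle_measure f"
proof -
  have "set_integrable lborel {-pi..pi} f"
    unfolding set_integrable_def
    by (rule borel_integrable_compact) (use assms continuous_on_subset in auto)
  then show ?thesis by (simp add: integrable_restrict_space set_integrable_def)
qed

lemma gaussian_first_moment_circle:
  assumes a: "0 < a"
  shows "(LINT t|unit_circle_measure. \<bar>t\<bar> * exp (- a * t\<^sup>2)) \<le> 1 / a"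
proof -
  let ?f = "\<lambda>t :: real. \<bar>t\<bar> * exp (- a * t\<^sup>2)"
  let ?F = "\<lambda>t :: real. - exp (- a * t\<^sup>2) / (2 * a)"
  \<comment> \<open>an antiderivative on the positive half; its negative serves on the negative half\<close>
  have D: "(?F has_real_derivative t * exp (- a * t\<^sup>2)) (at t within S)" for t S
    using a by (auto intro!: derivative_eq_intros)
  have D': "((\<lambda>t. - ?F t) has_real_derivative - (t * exp (- a * t\<^sup>2))) (at t within S)" for t S
    using D by (rule DERIV_minus)
  have "(?f has_integral (?F pi - ?F 0)) {0..pi}"
  proof (rule has_integral_eq[where f="\<lambda>t. t * exp (- a * t\<^sup>2)"])
    show "((\<lambda>t. t * exp (- a * t\<^sup>2)) has_integral (?F pi - ?F 0)) {0..pi}"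
      using D by (intro fundamental_theorem_of_calculus) (auto simp: has_real_derivative_iff_has_vector_derivative)
  qed auto
  moreover have "(?f has_integral (- ?F 0 - (- ?F (-pi)))) {-pi..0}"
  proof (rule has_integral_eq[where f="\<lambda>t. - (t * exp (- a * t\<^sup>2))"])
    show "((\<lambda>t. - (t * exp (- a * t\<^sup>2))) has_integral (- ?F 0 - (- ?F (-pi)))) {-pi..0}"
      using D' by (intro fundamental_theorem_of_calculus) (auto simp: has_real_derivative_iff_has_vector_derivative)
  qed auto
  ultimately have hi: "(?f has_integral ((- ?F 0 - (- ?F (-pi))) + (?F pi - ?F 0))) {-pi..pi}"
    by (intro has_integral_combine[of "-pi" 0 pi]) auto
  have si: "set_integrable lborel {-pi..pi} ?f"
    unfolding set_integrable_def
    by (rule borel_integrable_compact) (auto intro!: continuous_intros)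
  have "(LINT t:{-pi..pi}|lborel. ?f t) = integral {-pi..pi} ?f"
    using si by (rule set_borel_integral_eq_integral(2))
  also have "\<dots> = ((- ?F 0 - (- ?F (-pi))) + (?F pi - ?F 0))"
    using hi by (rule integral_unique)
  also have "\<dots> = (1 - exp (- a * pi\<^sup>2)) / a"
    by (simp add: diff_divide_distrib)
  also have "\<dots> \<le> 1 / a" using a by (intro divide_right_mono) auto
  finally show ?thesis
    by (subst integral_restrict_space) (auto simp: set_lebesgue_integral_def)
qed

lemma measure_circle_Icc:
  assumes "0 \<le> \<tau>" "\<tau> \<le> pi"
  shows "(LINT t|unit_circle_measure. indicator {-\<tau>..\<tau>} t :: real) = 2 * \<tau>"
proof -
  have "{-\<tau>..\<tau>} \<inter> space unit_circle_measure = {-\<tau>..\<tau>}"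
    using assms by (auto simp: space_restrict_space)
  then have "(LINT t|unit_circle_measure. indicator {-\<tau>..\<tau>} t :: real) = measure unit_circle_measure {-\<tau>..\<tau>}"
    by (simp only: Bochner_Integration.integral_indicator)
  also have "\<dots> = measure lborel {-\<tau>..\<tau>}"
    using assms by (intro measure_restrict_space) auto
  finally show ?thesis using assms by simp
qed

text \<open>This is the form in which bounds on characteristic functions enter: \<open>g\<close> is the modulus of a
characteristic function, Gaussian near the origin and below the small constant \<open>d\<close> elsewhere. Both the
comparison of the conditioned with the unconditioned law and the tail in the local limit estimate
need the first absolute moment of \<open>g\<close> only.\<close>

lemma integral_first_moment_bound:
  fixes g :: "real \<Rightarrow> real"
  assumes a: "0 < a" and d: "0 \<le> d" and g: "\<And>t. \<bar>t\<bar> \<le> pi \<Longrightarrow> g t \<le> exp (- a * t\<^sup>2) + d"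
    and cont: "continuous_on UNIV g"
  shows "(LINT t|unit_circle_measure. \<bar>t\<bar> * g t) \<le> 1 / a + 2 * pi\<^sup>2 * d"
proof -
  have "(LINT t|unit_circle_measure. \<bar>t\<bar> * g t) \<le> (LINT t|unit_circle_measure. \<bar>t\<bar> * exp (- a * t\<^sup>2) + pi * d)"
  proof (rule integral_mono)
    fix t assume "t \<in> space unit_circle_measure"
    then have t: "\<bar>t\<bar> \<le> pi" by (auto simp: space_restrict_space)
    have "\<bar>t\<bar> * g t \<le> \<bar>t\<bar> * (exp (- a * t\<^sup>2) + d)" using g[OF t] by (intro mult_left_mono) auto
    also have "\<dots> \<le> \<bar>t\<bar> * exp (- a * t\<^sup>2) + pi * d"
      using t d by (simp add: ring_distribs mult_right_mono)
    finally show "\<bar>t\<bar> * g t \<le> \<bar>t\<bar> * exp (- a * t\<^sup>2) + pi * d" .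
  qed (auto intro!: integrable_circle continuous_intros cont)
  also have "\<dots> = (LINT t|unit_circle_measure. \<bar>t\<bar> * exp (- a * t\<^sup>2)) + (LINT t|unit_circle_measure. pi * d)"
    by (intro Bochner_Integration.integral_add integrable_circle) (auto intro!: continuous_intros)
  also have "(LINT t|unit_circle_measure. pi * d) = 2 * pi\<^sup>2 * d"
  proof -
    have "measure unit_circle_measure (space unit_circle_measure) = 2 * pi"
      by (simp add: measure_restrict_space space_restrict_space)
    then show ?thesis by (simp add: power2_eq_square)
  qed
  finally show ?thesis using gaussian_first_moment_circle[OF a] by linarith
qed

section \<open>Independent Poisson variables and the effect of conditioning on their total\<close>

text \<open>Everything up to the asymptotics concerns one ground set size \<open>n\<close>, one integer bound \<open>N\<close> on the cycle
lengths and the corresponding solution \<open>x\<close> of the saddle point equation.\<close>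

locale saddle =
  fixes N n :: nat and x :: real
  assumes x_pos: "0 < x" and saddle_eq: "(\<Sum>j=1..N. x ^ j) = real n"
begin

text \<open>The parameters of the independent Poisson variables: with these, the mean of \<open>total\<close> below is \<open>n\<close>,
  by the defining equation of the saddle point. This is \<^const>\<open>cycle_mu\<close>.\<close>

definition mu :: "nat \<Rightarrow> real" where "mu j = x ^ j / real j"

definition total :: "(nat \<Rightarrow> nat) \<Rightarrow> nat" where "total c = (\<Sum>j=1..N. j * c j)"

text \<open>The reference law: independent Poisson variables in place of the cycle counts. The
  default value 0 outside of \<open>{1..N}\<close> matches the cycle types of permutations with short cycles.\<close>

definition law :: "(nat \<Rightarrow> nat) pmf" where
  "law = Pi_pmf {1..N} 0 (\<lambda>j. poisson_pmf (mu j))"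

definition short :: "(nat \<Rightarrow> nat) set" where
  "short = {\<sigma>. \<sigma> permutes {1..n} \<and> (\<forall>c\<in>orbit \<sigma> ` {1..n}. card c \<le> N)}"

text \<open>The modulus of the characteristic function of \<open>\<Sum>j\<in>M. j * c j\<close> at \<open>t\<close> is \<open>exp (- expon M t)\<close>.\<close>

definition expon :: "nat set \<Rightarrow> real \<Rightarrow> real" where
  "expon M t = (\<Sum>j\<in>M. mu j * (1 - cos (t * j)))"

text \<open>The variance of \<open>\<Sum>j\<in>M. j * c j\<close> under \<open>law\<close>.\<close>

definition var :: "nat set \<Rightarrow> real" where
  "var M = (\<Sum>j\<in>M. (real j)\<^sup>2 * mu j)"

abbreviation hit :: real where "hit \<equiv> measure_pmf.expectation law (\<lambda>c. of_bool (total c = n))"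

lemma mu_pos: "1 \<le> j \<Longrightarrow> 0 < mu j"
  using x_pos by (simp add: mu_def)

lemma mu_nonneg: "0 \<le> mu j"
  using x_pos by (simp add: mu_def)

lemma expon_nonneg: "0 \<le> expon M t"
  unfolding expon_def using mu_nonneg by (intro sum_nonneg mult_nonneg_nonneg) auto

lemma continuous_on_expon: "continuous_on A (expon M)"
  unfolding expon_def by (intro continuous_intros)

lemma var_nonneg: "0 \<le> var M"
  unfolding var_def using mu_nonneg by (intro sum_nonneg mult_nonneg_nonneg) auto

lemma char_partial_size:
  assumes "M \<subseteq> {1..N}"
  shows "measure_pmf.expectation law (\<lambda>c. cis (t * real (\<Sum>j\<in>M. j * c j))) =
     exp (\<Sum>j\<in>M. of_real (mu j) * (cis (t * j) - 1))"
proof -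
  have fin: "finite M" using assms finite_subset by blast
  have "(\<lambda>c. cis (t * real (\<Sum>j\<in>M. j * c j))) = (\<lambda>c. \<Prod>j\<in>M. cis ((t * j) * real (c j)))"
    using fin by (simp add: cis_conv_exp exp_sum sum_distrib_left sum_distrib_right mult_ac of_nat_sum)
  then have "measure_pmf.expectation law (\<lambda>c. cis (t * real (\<Sum>j\<in>M. j * c j))) =
     measure_pmf.expectation law (\<lambda>c. \<Prod>j\<in>M. cis ((t * j) * real (c j)))"
    by simp
  also have "\<dots> = (\<Prod>j\<in>M. measure_pmf.expectation (poisson_pmf (mu j)) (\<lambda>k. cis ((t * j) * real k)))"
    unfolding law_def using assms by (intro expectation_Pi_pmf_prod) auto
  also have "\<dots> = (\<Prod>j\<in>M. exp (of_real (mu j) * (cis (t * j) - 1)))"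
    using assms mu_pos by (intro prod.cong expectation_poisson_cis) auto
  finally show ?thesis using fin by (simp add: exp_sum)
qed

lemma norm_char_partial_size:
  assumes "M \<subseteq> {1..N}"
  shows "norm (measure_pmf.expectation law (\<lambda>c. cis (t * real (\<Sum>j\<in>M. j * c j)))) = exp (- expon M t)"
  unfolding char_partial_size[OF assms]
  by (simp add: expon_def Re_sum sum_negf[symmetric] algebra_simps)

text \<open>Only the characteristic function enters: \<open>1 - |\<phi>|\<^sup>2 \<le> 2 * expon M t \<le> t\<^sup>2 * var M\<close>, by
\<open>1 - exp (- u) \<le> u\<close> and \<open>1 - cos y \<le> y\<^sup>2 / 2\<close>.\<close>

lemma partial_size_deviation:
  assumes "M \<subseteq> {1..N}"
  defines "Z \<equiv> \<lambda>t c. cis (t * real (\<Sum>j\<in>M. j * c j))"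
  shows "measure_pmf.expectation law (\<lambda>c. norm (Z t c - measure_pmf.expectation law (Z t))) \<le> \<bar>t\<bar> * sqrt (var M)"
proof -
  have "1 - (exp (- expon M t))\<^sup>2 \<le> 2 * expon M t"
  proof -
    have "(exp (- expon M t))\<^sup>2 = exp (- (2 * expon M t))" by (simp add: exp_double[symmetric])
    moreover have "1 + (- (2 * expon M t)) \<le> exp (- (2 * expon M t))" by (rule exp_ge_add_one_self)
    ultimately show ?thesis by linarith
  qed
  also have "2 * expon M t \<le> t\<^sup>2 * var M"
    unfolding expon_def var_def sum_distrib_left
  proof (intro sum_mono)
    fix j
    have "mu j * (1 - cos (t * j)) \<le> mu j * ((t * j)\<^sup>2 / 2)"
      by (intro mult_left_mono one_minus_cos_le mu_nonneg)
    then show "2 * (mu j * (1 - cos (t * real j))) \<le> t\<^sup>2 * ((real j)\<^sup>2 * mu j)"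
      by (simp add: power_mult_distrib algebra_simps)
  qed
  finally have *: "1 - (exp (- expon M t))\<^sup>2 \<le> t\<^sup>2 * var M" .
  have "measure_pmf.expectation law (\<lambda>c. norm (Z t c - measure_pmf.expectation law (Z t)))
      \<le> sqrt (1 - (norm (measure_pmf.expectation law (Z t)))\<^sup>2)"
    by (rule expectation_deviation_unit_circle) (simp add: Z_def)
  also have "\<dots> \<le> sqrt (t\<^sup>2 * var M)"
    using * norm_char_partial_size[OF assms(1)] unfolding Z_def by simp
  finally show ?thesis by (simp add: real_sqrt_mult)
qed

text \<open>The covariance of \<open>F\<close> with the event \<open>total c = n\<close>. Write \<open>total = S + T\<close>, where \<open>S\<close> collects the
coordinates in \<open>M\<close>, on which \<open>F\<close> depends, and \<open>T\<close> the others. By Fourier inversion and independence the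
covariance is an average over \<open>t\<close> of \<open>E (cis (t T))\<close> times the covariance of \<open>F\<close> with \<open>cis (t S)\<close>. The latter is at
most \<open>B * E|cis (t S) - E cis (t S)| \<le> B * |t| * sqrt (var M)\<close>.\<close>

lemma hit_covariance_bound:
  fixes F :: "(nat \<Rightarrow> nat) \<Rightarrow> real"
  assumes M: "M \<subseteq> {1..N}"
    and F: "\<And>c c'. (\<And>j. j \<in> M \<Longrightarrow> c j = c' j) \<Longrightarrow> F c = F c'" "\<And>c. \<bar>F c\<bar> \<le> B"
  shows "\<bar>measure_pmf.expectation law (\<lambda>c. F c * of_bool (total c = n)) - measure_pmf.expectation law F * hit\<bar>
     \<le> B * sqrt (var M) / (2 * pi) * (LINT t|unit_circle_measure. \<bar>t\<bar> * exp (- expon ({1..N} - M) t))"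
proof -
  let ?E = "measure_pmf.expectation law"
  let ?M' = "{1..N} - M"
  define F' where "F' c = complex_of_real (F c)" for c
  define Z where "Z t c = cis (t * real (\<Sum>j\<in>M. j * c j))" for t and c :: "nat \<Rightarrow> nat"
  define W where "W t c = cis (t * real (\<Sum>j\<in>?M'. j * c j))" for t and c :: "nat \<Rightarrow> nat"
  have split: "cis (t * (real (total c) - real n)) = cis (- t * n) * (Z t c * W t c)" for t c
  proof -
    have "total c = (\<Sum>j\<in>M. j * c j) + (\<Sum>j\<in>?M'. j * c j)"
      unfolding total_def using M by (subst sum.subset_diff[of M]) (auto simp: add.commute)
    then show ?thesis by (simp add: Z_def W_def cis_mult algebra_simps)
  qed
  have Znorm: "norm (Z t c) = 1" "norm (W t c) = 1" for t c by (auto simp: Z_def W_def)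
  have B: "0 \<le> B" using F(2)[of undefined] by linarith
  have intF': "integrable law F'" by (rule integrable_measure_pmf_bounded[of _ B]) (simp add: F'_def F(2))
  have intZ: "integrable law (Z t)" for t by (rule integrable_measure_pmf_bounded[of _ 1]) (simp add: Znorm)
  have intF'Z: "integrable law (\<lambda>c. F' c * Z t c)" for t
    by (rule integrable_measure_pmf_bounded[of _ B]) (simp add: F'_def F(2) norm_mult Znorm)
  have ZM: "Z t c = Z t c'" if "\<And>j. j \<in> M \<Longrightarrow> c j = c' j" for t c c'
  proof -
    have "(\<Sum>j\<in>M. j * c j) = (\<Sum>j\<in>M. j * c' j)" by (rule sum.cong) (simp_all add: that)
    then show ?thesis by (simp only: Z_def)
  qed
  have WM: "W t c = W t c'" if "\<And>j. j \<in> ?M' \<Longrightarrow> c j = c' j" for t c c'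
  proof -
    have "(\<Sum>j\<in>?M'. j * c j) = (\<Sum>j\<in>?M'. j * c' j)" by (rule sum.cong) (use that in simp_all)
    then show ?thesis by (simp only: W_def)
  qed
  have indep: "?E (\<lambda>c. H c * W t c) = ?E H * ?E (W t)"
    if H: "\<And>c c'. (\<And>j. j \<in> M \<Longrightarrow> c j = c' j) \<Longrightarrow> H c = H c'" "\<And>c. norm (H c) \<le> b" for H b t
    unfolding law_def
  proof (rule expectation_Pi_pmf_mult_indep[of _ M ?M' H b "W t" 1])
    show "H c = H c'" if "\<And>j. j \<in> M \<Longrightarrow> c j = c' j" for c c' using that by (rule H(1))
    show "W t c = W t c'" if "\<And>j. j \<in> ?M' \<Longrightarrow> c j = c' j" for c c' using that by (rule WM)
  qed (use M H(2) Znorm in auto)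
  \<comment> \<open>centring \<open>F\<close> turns the covariance into a single expectation, to which inversion applies\<close>
  define H where "H c = F' c - ?E F'" for c
  define h where "h t = ?E (\<lambda>c. H c * cis (t * (real (total c) - real n)))" for t
  have normE: "norm (?E F') \<le> B"
  proof -
    have "norm (?E F') \<le> ?E (\<lambda>c. norm (F' c))" by (rule integral_norm_bound)
    also have "\<dots> \<le> ?E (\<lambda>c. B)"
      by (intro integral_mono integrable_norm intF') (auto simp: F'_def F(2))
    finally show ?thesis by simp
  qed
  have Hb: "norm (H c) \<le> 2 * B" for c
    using norm_triangle_ineq4[of "F' c" "?E F'"] normE F(2)[of c] by (simp add: H_def F'_def)
  have h_eq: "h t = cis (- t * n) * ((?E (\<lambda>c. F' c * Z t c) - ?E F' * ?E (Z t)) * ?E (W t))" for t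
  proof -
    have "h t = ?E (\<lambda>c. cis (- t * n) * ((H c * Z t c) * W t c))"
      unfolding h_def split by (simp add: mult_ac)
    also have "\<dots> = cis (- t * n) * ?E (\<lambda>c. (H c * Z t c) * W t c)"
      by (rule integral_mult_right_zero)
    also have "?E (\<lambda>c. (H c * Z t c) * W t c) = ?E (\<lambda>c. H c * Z t c) * ?E (W t)"
    proof (rule indep[of _ "2 * B"])
      show "H c * Z t c = H c' * Z t c'" if "\<And>j. j \<in> M \<Longrightarrow> c j = c' j" for c c'
        using F(1)[of c c'] ZM[of c c'] that by (simp add: F'_def H_def)
    qed (simp add: Hb norm_mult Znorm)
    also have "?E (\<lambda>c. H c * Z t c) = ?E (\<lambda>c. F' c * Z t c) - ?E F' * ?E (Z t)"
      unfolding H_def using intF'Z intZ by (simp add: left_diff_distrib)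
    finally show ?thesis .
  qed
  have h_bound: "norm (h t) \<le> B * sqrt (var M) * (\<bar>t\<bar> * exp (- expon ?M' t))" for t
  proof -
    have "?E (\<lambda>c. F' c * Z t c) - ?E F' * ?E (Z t) = ?E (\<lambda>c. F' c * (Z t c - ?E (Z t)))"
      using intF' intF'Z by (simp add: right_diff_distrib)
    also have "norm \<dots> \<le> ?E (\<lambda>c. norm (F' c * (Z t c - ?E (Z t))))"
      by (rule integral_norm_bound)
    also have "\<dots> \<le> ?E (\<lambda>c. B * norm (Z t c - ?E (Z t)))"
    proof (rule integral_mono)
      show "integrable law (\<lambda>c. norm (F' c * (Z t c - ?E (Z t))))"
        using intF' intF'Z by (simp add: right_diff_distrib)
      show "integrable law (\<lambda>c. B * norm (Z t c - ?E (Z t)))" using intZ by simp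
    qed (auto simp: norm_mult F'_def F(2) mult_right_mono)
    also have "\<dots> = B * ?E (\<lambda>c. norm (Z t c - ?E (Z t)))" by simp
    also have "\<dots> \<le> B * (\<bar>t\<bar> * sqrt (var M))"
      using partial_size_deviation[OF M, of t] B unfolding Z_def by (intro mult_left_mono) auto
    finally have 1: "norm (?E (\<lambda>c. F' c * Z t c) - ?E F' * ?E (Z t)) \<le> B * (\<bar>t\<bar> * sqrt (var M))" .
    have "norm (?E (W t)) = exp (- expon ?M' t)"
      unfolding W_def by (rule norm_char_partial_size) auto
    then have "norm (h t) = exp (- expon ?M' t) * norm (?E (\<lambda>c. F' c * Z t c) - ?E F' * ?E (Z t))"
      unfolding h_eq norm_mult by simp
    also have "\<dots> \<le> exp (- expon ?M' t) * (B * (\<bar>t\<bar> * sqrt (var M)))"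
      using 1 by (intro mult_left_mono) auto
    finally show ?thesis by (simp add: mult_ac)
  qed
  have "norm (LINT t|unit_circle_measure. h t) \<le>
      (LINT t|unit_circle_measure. B * sqrt (var M) * (\<bar>t\<bar> * exp (- expon ?M' t)))" (is "_ \<le> ?R")
  proof (cases "integrable unit_circle_measure h")
    case True
    then show ?thesis
      by (rule Bochner_Integration.integral_norm_bound_integral)
         (use h_bound in \<open>auto intro!: integrable_circle continuous_intros continuous_on_expon\<close>)
  next
    case False
    then show ?thesis using B var_nonneg by (simp add: not_integrable_integral_eq integral_nonneg)
  qed
  moreover have "?E (\<lambda>c. H c * of_bool (total c = n)) = 1 / of_real (2 * pi) * (LINT t|unit_circle_measure. h t)"
    unfolding h_def by (rule fourier_inversion_pmf[OF Hb])
  moreover have "?E (\<lambda>c. H c * of_bool (total c = n)) =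
      of_real (?E (\<lambda>c. F c * of_bool (total c = n)) - ?E F * hit)"
  proof -
    have "(\<lambda>c. H c * of_bool (total c = n)) =
       (\<lambda>c. complex_of_real (F c * of_bool (total c = n) - ?E F * of_bool (total c = n)))"
      unfolding H_def F'_def[abs_def] by (auto simp: left_diff_distrib)
    then have "?E (\<lambda>c. H c * of_bool (total c = n)) =
       of_real (?E (\<lambda>c. F c * of_bool (total c = n) - ?E F * of_bool (total c = n)))"
      by (simp only: integral_complex_of_real)
    also have "?E (\<lambda>c. F c * of_bool (total c = n) - ?E F * of_bool (total c = n)) =
       ?E (\<lambda>c. F c * of_bool (total c = n)) - ?E F * hit"
    proof -
      have "integrable law (\<lambda>c. F c * of_bool (total c = n))"
        by (rule integrable_measure_pmf_bounded[of _ B]) (auto simp: F(2) B)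
      moreover have "integrable law (\<lambda>c. ?E F * of_bool (total c = n))"
        by (rule integrable_measure_pmf_bounded[of _ "\<bar>?E F\<bar>"]) auto
      ultimately show ?thesis by simp
    qed
    finally show ?thesis .
  qed
  ultimately have "norm (complex_of_real (?E (\<lambda>c. F c * of_bool (total c = n)) - ?E F * hit)) \<le> 1 / (2 * pi) * ?R"
    by (simp only: norm_mult) (simp add: norm_divide divide_right_mono)
  then show ?thesis unfolding norm_of_real integral_mult_right_zero by simp
qed

end

section \<open>The probability of the conditioning event, and the conditioned law\<close>

context saddle
begin

lemma mean_total: "(\<Sum>j=1..N. mu j * real j) = real n"
  unfolding saddle_eq[symmetric] by (intro sum.cong) (auto simp: mu_def)

text \<open>A local limit theorem with a crude constant (the true asymptotics is \<open>1 / sqrt (2 * pi * \<sigma>\<^sup>2)\<close>).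
As the mean of \<open>total\<close> is \<open>n\<close>, the probability of \<open>total c = n\<close> is the average of \<open>exp (w t)\<close> with
\<open>w t\<close> close to \<open>- \<sigma>\<^sup>2 * t\<^sup>2 / 2\<close> for small \<open>t\<close>; the error is cubic in \<open>t\<close>. The real part of
\<open>exp (w t)\<close> is therefore at least \<open>1 / 2\<close> up to the error on \<open>|t| \<le> 1 / \<sigma>\<close> and at least minus the error on
\<open>|t| \<le> \<tau>\<close>. Beyond \<open>\<tau>\<close> the modulus is at most \<open>|t| / \<tau>\<close> times itself, so that the first moment bound
controls the tail.\<close>

lemma hit_lower_bound:
  assumes N: "1 \<le> N" and d: "0 \<le> d"
    and \<sigma>: "0 < \<sigma>" "\<sigma>\<^sup>2 = var {1..N}"
    and decay: "\<And>t. \<bar>t\<bar> \<le> pi \<Longrightarrow> exp (- expon {1..N} t) \<le> exp (- (\<sigma>\<^sup>2 / 8) * t\<^sup>2) + d"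
    and d_small: "2 * pi\<^sup>2 * d \<le> 1 / \<sigma>\<^sup>2"
    and \<sigma>_large: "2000000 * real N \<le> \<sigma>"
  shows "1 / (4 * pi * \<sigma>) \<le> hit"
proof -
  let ?E = "measure_pmf.expectation law"
  define w where "w t = (\<Sum>j=1..N. of_real (mu j) * (cis (t * j) - 1 - \<i> * complex_of_real (t * j)))" for t :: real
  define g where "g t = exp (- expon {1..N} t)" for t
  \<comment> \<open>20 makes the tail at most \<open>9 / (20 * \<sigma>)\<close>, less than half of the main contribution \<open>1 / \<sigma>\<close>; the cubic error up to \<open>\<tau>\<close> is small by the assumption that \<open>\<sigma>\<close> is a large multiple of \<open>N\<close>\<close>
  define \<tau> where "\<tau> = 20 / \<sigma>"
  define err where "err = real N * \<sigma>\<^sup>2 * \<tau> ^ 3 / 6"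
  have \<sigma>_ge: "2000000 \<le> \<sigma>" using \<sigma>_large N by simp
  have \<tau>: "0 < \<tau>" "\<tau> \<le> pi" "1 / \<sigma> \<le> \<tau>"
  proof -
    show "0 < \<tau>" "1 / \<sigma> \<le> \<tau>" using \<sigma> by (auto simp: \<tau>_def divide_right_mono)
    have "\<tau> \<le> 20 / 2000000" unfolding \<tau>_def using \<sigma>_ge by (intro divide_left_mono) auto
    then show "\<tau> \<le> pi" using pi_gt3 by simp
  qed
  have char: "?E (\<lambda>c. cis (t * (real (total c) - real n))) = exp (w t)" for t
  proof -
    have "(\<lambda>c. cis (t * (real (total c) - real n))) = (\<lambda>c. cis (- t * n) * cis (t * real (\<Sum>j\<in>{1..N}. j * c j)))"
      by (simp add: total_def cis_mult algebra_simps)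
    then have "?E (\<lambda>c. cis (t * (real (total c) - real n))) =
       cis (- t * n) * ?E (\<lambda>c. cis (t * real (\<Sum>j\<in>{1..N}. j * c j)))"
      by (simp only: integral_mult_right_zero)
    also have "\<dots> = exp (- (\<i> * t * n) + (\<Sum>j=1..N. of_real (mu j) * (cis (t * j) - 1)))"
      by (subst char_partial_size) (auto simp: cis_conv_exp exp_add[symmetric] algebra_simps)
    also have "- (\<i> * t * n) + (\<Sum>j=1..N. of_real (mu j) * (cis (t * j) - 1)) = w t"
    proof -
      have "w t = (\<Sum>j=1..N. of_real (mu j) * (cis (t * j) - 1)) - \<i> * t * of_real (\<Sum>j=1..N. mu j * real j)"
        unfolding w_def of_real_sum sum_distrib_left sum_subtractf[symmetric]
        by (intro sum.cong) (auto simp: algebra_simps)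
      then show ?thesis unfolding mean_total by simp
    qed
    finally show ?thesis .
  qed
  have Re_w: "Re (w t) = - expon {1..N} t" for t
    unfolding w_def expon_def by (simp add: Re_sum sum_negf[symmetric] algebra_simps)
  have norm_w: "norm (exp (w t)) = g t" for t
    by (simp add: Re_w g_def)
  have w_approx: "norm (w t - of_real (- (\<sigma>\<^sup>2 * t\<^sup>2 / 2))) \<le> real N * \<sigma>\<^sup>2 * \<bar>t\<bar> ^ 3 / 6" for t
  proof -
    have "w t - of_real (- (\<sigma>\<^sup>2 * t\<^sup>2 / 2)) =
       (\<Sum>j=1..N. of_real (mu j) * (cis (t * j) - 1 - \<i> * complex_of_real (t * j) + (complex_of_real (t * j))\<^sup>2 / 2))"
    proof -
      have "\<sigma>\<^sup>2 * t\<^sup>2 / 2 = (\<Sum>j=1..N. mu j * ((t * j)\<^sup>2 / 2))"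
        unfolding \<sigma> var_def sum_distrib_right sum_divide_distrib
        by (intro sum.cong) (auto simp: power_mult_distrib)
      then have "complex_of_real (\<sigma>\<^sup>2 * t\<^sup>2 / 2) = (\<Sum>j=1..N. of_real (mu j) * ((complex_of_real (t * j))\<^sup>2 / 2))"
        by (simp del: of_real_power of_real_mult add: of_real_sum) simp
      then have "w t - of_real (- (\<sigma>\<^sup>2 * t\<^sup>2 / 2)) = w t + (\<Sum>j=1..N. of_real (mu j) * ((complex_of_real (t * j))\<^sup>2 / 2))"
        by (simp only: of_real_minus diff_minus_eq_add)
      then show ?thesis
        unfolding w_def sum.distrib[symmetric] by (simp add: ring_distribs)
    qed
    also have "norm \<dots> \<le> (\<Sum>j=1..N. mu j * (\<bar>t * j\<bar> ^ 3 / 6))"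
    proof (intro sum_norm_le)
      fix j
      show "norm (of_real (mu j) * (cis (t * j) - 1 - \<i> * complex_of_real (t * j) + (complex_of_real (t * j))\<^sup>2 / 2))
          \<le> mu j * (\<bar>t * j\<bar> ^ 3 / 6)"
        unfolding norm_mult norm_of_real abs_of_nonneg[OF mu_nonneg]
        by (rule mult_left_mono[OF cis_minus_linear_bound[of "t * j"] mu_nonneg])
    qed
    also have "\<dots> \<le> (\<Sum>j=1..N. (\<bar>t\<bar> ^ 3 / 6) * (real N * ((real j)\<^sup>2 * mu j)))"
    proof (intro sum_mono)
      fix j assume "j \<in> {1..N}"
      then have "real j * ((real j)\<^sup>2 * mu j) \<le> real N * ((real j)\<^sup>2 * mu j)"
        using mu_nonneg by (intro mult_right_mono mult_nonneg_nonneg) auto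
      then have "(\<bar>t\<bar> ^ 3 / 6) * (real j * ((real j)\<^sup>2 * mu j)) \<le> (\<bar>t\<bar> ^ 3 / 6) * (real N * ((real j)\<^sup>2 * mu j))"
        by (intro mult_left_mono) auto
      then show "mu j * (\<bar>t * j\<bar> ^ 3 / 6) \<le> (\<bar>t\<bar> ^ 3 / 6) * (real N * ((real j)\<^sup>2 * mu j))"
        by (simp add: abs_mult power_mult_distrib power3_eq_cube power2_eq_square mult_ac)
    qed
    also have "\<dots> = real N * \<sigma>\<^sup>2 * \<bar>t\<bar> ^ 3 / 6"
      unfolding \<sigma> var_def by (simp add: sum_distrib_left sum_distrib_right mult_ac)
    finally show ?thesis .
  qed
  have Re_lower: "1 / 2 * indicator {- (1 / \<sigma>)..1 / \<sigma>} t - err * indicator {-\<tau>..\<tau>} t - 1 / \<tau> * (\<bar>t\<bar> * g t) \<le> Re (exp (w t))" for t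
  proof (cases "\<bar>t\<bar> \<le> \<tau>")
    case True
    have "\<bar>Re (exp (w t) - exp (of_real (- (\<sigma>\<^sup>2 * t\<^sup>2 / 2))))\<bar> \<le> norm (w t - of_real (- (\<sigma>\<^sup>2 * t\<^sup>2 / 2)))"
      by (rule order_trans[OF abs_Re_le_cmod norm_exp_diff_le]) (auto simp: Re_w expon_nonneg)
    also have "\<dots> \<le> real N * \<sigma>\<^sup>2 * \<bar>t\<bar> ^ 3 / 6" by (rule w_approx)
    also have "\<dots> \<le> err" unfolding err_def using True by (intro divide_right_mono mult_left_mono power_mono) auto
    finally have 1: "exp (- (\<sigma>\<^sup>2 * t\<^sup>2 / 2)) - err \<le> Re (exp (w t))" 
      unfolding exp_of_real by (simp add: abs_le_iff)
    have 2: "1 / 2 * indicator {- (1 / \<sigma>)..1 / \<sigma>} t \<le> exp (- (\<sigma>\<^sup>2 * t\<^sup>2 / 2))"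
    proof (cases "\<bar>t\<bar> \<le> 1 / \<sigma>")
      case True
      then have "\<bar>\<sigma> * t\<bar> \<le> 1" using \<sigma> by (simp add: abs_mult field_simps)
      then have "(\<sigma> * t)\<^sup>2 \<le> 1" by (simp add: abs_square_le_1)
      then have "1 / 2 \<le> 1 + (- (\<sigma>\<^sup>2 * t\<^sup>2 / 2))" by (simp add: power_mult_distrib)
      also have "\<dots> \<le> exp (- (\<sigma>\<^sup>2 * t\<^sup>2 / 2))" by (rule exp_ge_add_one_self)
      finally show ?thesis by (auto simp: indicator_def)
    qed (auto simp: indicator_def)
    have 3: "0 \<le> 1 / \<tau> * (\<bar>t\<bar> * g t)" using \<tau> by (simp add: g_def)
    have "indicator {-\<tau>..\<tau>} t = (1 :: real)" using True by (auto simp: indicator_def)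
    then show ?thesis using 1 2 3 by simp
  next
    case False
    then have "indicator {-\<tau>..\<tau>} t = (0 :: real)" "indicator {- (1 / \<sigma>)..1 / \<sigma>} t = (0 :: real)"
      using \<tau>(3) by (auto simp: indicator_def)
    moreover have "- g t \<le> Re (exp (w t))"
      using abs_Re_le_cmod[of "exp (w t)"] norm_w[of t] by simp
    moreover have "1 * g t \<le> (1 / \<tau> * \<bar>t\<bar>) * g t"
      using False \<tau> by (intro mult_right_mono) (auto simp: g_def)
    ultimately show ?thesis by simp
  qed
  have g_cont: "continuous_on UNIV g" unfolding g_def by (intro continuous_intros continuous_on_expon)
  have ind_int: "integrable unit_circle_measure (\<lambda>t. indicator {-s..s} t :: real)" for s
    using finite_measure_restrict_Icc[of "-pi" pi]
    by (intro finite_measure.integrable_const_bound[of _ _ 1]) (auto simp: indicator_def intro!: measurable_restrict_space1)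
  have gi: "integrable unit_circle_measure (\<lambda>t. \<bar>t\<bar> * g t)"
    by (intro integrable_circle continuous_intros g_cont)
  have w_cont: "continuous_on UNIV (\<lambda>t. exp (w t))"
    unfolding w_def by (intro continuous_intros)
  have moment: "(LINT t|unit_circle_measure. \<bar>t\<bar> * g t) \<le> 9 / \<sigma>\<^sup>2"
  proof -
    have "(LINT t|unit_circle_measure. \<bar>t\<bar> * g t) \<le> 1 / (\<sigma>\<^sup>2 / 8) + 2 * pi\<^sup>2 * d"
    proof (rule integral_first_moment_bound)
      show "0 < \<sigma>\<^sup>2 / 8" using \<sigma>(1) by simp
    qed (use d decay g_cont in \<open>auto simp: g_def\<close>)
    then show ?thesis using d_small by simp
  qed
  have "1 / (2 * \<sigma>) \<le> 1 / 2 * (2 * (1 / \<sigma>)) - err * (2 * \<tau>) - 1 / \<tau> * (9 / \<sigma>\<^sup>2)"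
  proof -
    have "err * (2 * \<tau>) = real N * \<sigma>\<^sup>2 * (\<tau> ^ 4 / 3)" 
      unfolding err_def by (simp add: power4_eq_xxxx power3_eq_cube)
    also have "\<dots> = (160000 / 3) * real N / \<sigma>\<^sup>2"
      using \<sigma>(1) by (simp add: \<tau>_def power4_eq_xxxx power2_eq_square field_simps)
    also have "\<dots> \<le> (160000 / 3) * (\<sigma> / 2000000) / \<sigma>\<^sup>2"
      using \<sigma>_large by (intro divide_right_mono mult_left_mono) auto
    also have "\<dots> = (160000 / 6000000) * (1 / \<sigma>)" using \<sigma>(1) by (simp add: power2_eq_square field_simps)
    finally have 1: "err * (2 * \<tau>) \<le> (160000 / 6000000) * (1 / \<sigma>)" .
    have 2: "1 / \<tau> * (9 / \<sigma>\<^sup>2) = (9 / 20) * (1 / \<sigma>)" using \<sigma>(1) by (simp add: \<tau>_def power2_eq_square field_simps)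
    define u where "u = 1 / \<sigma>"
    have u: "0 < u" using \<sigma>(1) by (simp add: u_def)
    have e: "1 / (2 * \<sigma>) = u / 2" by (simp add: u_def)
    show ?thesis using 1 u unfolding e 2 u_def[symmetric] by linarith
  qed
  also have "\<dots> \<le> 1 / 2 * (2 * (1 / \<sigma>)) - err * (2 * \<tau>) - 1 / \<tau> * (LINT t|unit_circle_measure. \<bar>t\<bar> * g t)"
    using moment \<tau> by (intro diff_left_mono mult_left_mono) auto
  also have "\<dots> = (LINT t|unit_circle_measure. 1 / 2 * indicator {- (1 / \<sigma>)..1 / \<sigma>} t - err * indicator {-\<tau>..\<tau>} t - 1 / \<tau> * (\<bar>t\<bar> * g t))"
  proof -
    have "1 / \<sigma> \<le> pi" using \<tau> by simp
    then have "(LINT t|unit_circle_measure. indicator {- (1 / \<sigma>)..1 / \<sigma>} t) = 2 * (1 / \<sigma>)"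
      "(LINT t|unit_circle_measure. indicator {-\<tau>..\<tau>} t) = 2 * \<tau>"
      using \<tau> \<sigma> by (intro measure_circle_Icc; simp)+
    moreover have "(LINT t|unit_circle_measure. 1 / 2 * indicator {- (1 / \<sigma>)..1 / \<sigma>} t - err * indicator {-\<tau>..\<tau>} t - 1 / \<tau> * (\<bar>t\<bar> * g t))
       = (LINT t|unit_circle_measure. 1 / 2 * indicator {- (1 / \<sigma>)..1 / \<sigma>} t) - (LINT t|unit_circle_measure. err * indicator {-\<tau>..\<tau>} t)
         - (LINT t|unit_circle_measure. 1 / \<tau> * (\<bar>t\<bar> * g t))"
      by (subst Bochner_Integration.integral_diff; (subst Bochner_Integration.integral_diff)?;
          intro Bochner_Integration.integrable_diff integrable_mult_right ind_int gi refl)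
    ultimately show ?thesis by (simp only: integral_mult_right_zero)
  qed
  also have "\<dots> \<le> (LINT t|unit_circle_measure. Re (exp (w t)))"
  proof (rule integral_mono)
    show "integrable unit_circle_measure (\<lambda>t. Re (exp (w t)))"
      by (intro integrable_circle continuous_on_Re w_cont)
  qed (intro Bochner_Integration.integrable_diff integrable_mult_right ind_int gi Re_lower)+
  finally have *: "1 / (2 * \<sigma>) \<le> (LINT t|unit_circle_measure. Re (exp (w t)))" .
  have "complex_of_real hit = ?E (\<lambda>c. 1 * of_bool (total c = n))"
    by (subst integral_complex_of_real[symmetric]) (simp add: of_bool_def if_distrib cong: if_cong)
  also have "\<dots> = 1 / of_real (2 * pi) * (LINT t|unit_circle_measure. ?E (\<lambda>c. 1 * cis (t * (real (total c) - real n))))"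
    by (rule fourier_inversion_pmf[of _ 1]) simp
  also have "\<dots> = of_real (1 / (2 * pi)) * (LINT t|unit_circle_measure. exp (w t))"
    by (simp add: char)
  finally have eq: "complex_of_real hit = of_real (1 / (2 * pi)) * (LINT t|unit_circle_measure. exp (w t))" .
  have Re_mult: "Re (of_real r * z) = r * Re z" for r z by simp
  from eq have "Re (complex_of_real hit) = Re (of_real (1 / (2 * pi)) * (LINT t|unit_circle_measure. exp (w t)))"
    by (rule arg_cong)
  then have "hit = 1 / (2 * pi) * Re (LINT t|unit_circle_measure. exp (w t))"
    unfolding Re_mult Re_complex_of_real .
  also have "Re (LINT t|unit_circle_measure. exp (w t)) = (LINT t|unit_circle_measure. Re (exp (w t)))"
    by (intro integral_Re[symmetric] integrable_circle w_cont)
  finally have "hit = 1 / (2 * pi) * (LINT t|unit_circle_measure. Re (exp (w t)))" .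
  moreover have "1 / (2 * pi) * (1 / (2 * \<sigma>)) \<le> 1 / (2 * pi) * (LINT t|unit_circle_measure. Re (exp (w t)))"
    using * by (intro mult_left_mono) auto
  ultimately show ?thesis by (simp add: mult_ac)
qed

text \<open>The vector of cycle counts of a random permutation with short cycles has the law of independent
Poisson variables conditioned on \<open>total c = n\<close>. Both laws have a density proportional to
\<open>cauchy_weight N\<close> on the vectors of total \<open>n\<close>: the first by Cauchy's formula, the second because the
powers of \<open>x\<close> in the Poisson probabilities combine to the constant \<open>x ^ n\<close>.\<close>

lemma expectation_short_conditioning:
  fixes F :: "(nat \<Rightarrow> nat) \<Rightarrow> real"
  assumes ne: "short \<noteq> {}"
  shows "measure_pmf.expectation (pmf_of_set short) (\<lambda>\<sigma>. F (cycle_type {1..n} \<sigma>)) =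
    measure_pmf.expectation law (\<lambda>c. F c * of_bool (total c = n)) / hit"
proof -
  define C where "C = {c. (\<forall>j. j \<notin> {1..N} \<longrightarrow> c j = 0) \<and> total c = n}"
  \<comment> \<open>the factor by which Poisson probabilities exceed Cauchy weights\<close>
  define K where "K = x ^ n * exp (- (\<Sum>j=1..N. mu j))"
  let ?w = "cauchy_weight N"
  let ?ct = "cycle_type {1..n}"
  have K: "0 < K" using x_pos by (simp add: K_def)
  have finC: "finite C"
  proof (rule finite_subset)
    show "C \<subseteq> PiE_dflt {1..N} 0 (\<lambda>_. {..n})"
    proof
      fix c assume c: "c \<in> C"
      have "c j \<le> n" if "j \<in> {1..N}" for j
      proof -
        have "c j \<le> j * c j" using that by auto
        also have "\<dots> \<le> total c" unfolding total_def using that by (intro member_le_sum) auto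
        finally show ?thesis using c by (simp add: C_def)
      qed
      then show "c \<in> PiE_dflt {1..N} 0 (\<lambda>_. {..n})" using c by (auto simp: C_def PiE_dflt_def)
    qed
  qed auto
  have finS: "finite short"
    unfolding short_def by (rule finite_subset[OF _ finite_permutations[of "{1..n}"]]) auto
  have ct_in: "?ct \<sigma> \<in> C" if "\<sigma> \<in> short" for \<sigma>
  proof -
    have p: "\<sigma> permutes {1..n}" using that by (simp add: short_def)
    have z: "?ct \<sigma> j = 0" if j: "j \<notin> {1..N}" for j
    proof -
      have "card c \<noteq> j" if "c \<in> orbit \<sigma> ` {1..n}" for c
      proof -
        obtain y where y: "y \<in> {1..n}" "c = orbit \<sigma> y" using \<open>c \<in> _\<close> by blast
        have "finite c" using permutes_orbit_subset[OF p y(1)] y(2) finite_subset by blast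
        moreover have "c \<noteq> {}" using y orbit_nonempty by metis
        ultimately have "1 \<le> card c" by (simp add: Suc_le_eq card_gt_0_iff)
        moreover have "card c \<le> N" using \<open>\<sigma> \<in> short\<close> \<open>c \<in> _\<close> unfolding short_def by blast
        ultimately show ?thesis using j by auto
      qed
      then have "{c \<in> orbit \<sigma> ` {1..n}. card c = j} = {}" by blast
      then show ?thesis by (simp only: cycle_type_def card.empty)
    qed
    have "finite {\<sigma>'. \<sigma>' permutes {1..n} \<and> ?ct \<sigma>' = ?ct \<sigma>}"
      by (rule finite_subset[OF _ finite_permutations[of "{1..n}"]]) auto
    then have "0 < card {\<sigma>'. \<sigma>' permutes {1..n} \<and> ?ct \<sigma>' = ?ct \<sigma>}"
      using p by (auto simp: card_gt_0_iff)
    then have "(\<Sum>j=1..N. j * ?ct \<sigma> j) = card {1..n}"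
      using count_cycle_type[of "{1..n}" N "?ct \<sigma>"] z by (auto split: if_splits)
    then show ?thesis using z by (simp add: C_def total_def)
  qed
  have fiber: "{\<sigma> \<in> short. ?ct \<sigma> = c} = {\<sigma>. \<sigma> permutes {1..n} \<and> ?ct \<sigma> = c}" if c: "c \<in> C" for c
  proof -
    have "\<sigma> \<in> short" if \<sigma>: "\<sigma> permutes {1..n}" "?ct \<sigma> = c" for \<sigma>
    proof -
      have "card b \<le> N" if b: "b \<in> orbit \<sigma> ` {1..n}" for b
      proof (rule ccontr)
        assume "\<not> card b \<le> N"
        then have "?ct \<sigma> (card b) = 0" using c \<sigma> by (simp add: C_def)
        then show False using b by (auto simp: cycle_type_def)
      qed
      then show ?thesis using \<sigma> by (simp add: short_def)
    qed
    then show ?thesis by (auto simp: short_def)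
  qed
  have sum_short: "(\<Sum>\<sigma>\<in>short. G (?ct \<sigma>)) = fact n * (\<Sum>c\<in>C. G c * ?w c)" for G :: "_ \<Rightarrow> real"
  proof -
    have "(\<Sum>\<sigma>\<in>short. G (?ct \<sigma>)) = (\<Sum>c\<in>C. \<Sum>\<sigma>\<in>{\<sigma> \<in> short. ?ct \<sigma> = c}. G (?ct \<sigma>))"
      using finS finC ct_in by (intro sum.group[symmetric]) auto
    also have "\<dots> = (\<Sum>c\<in>C. real (card {\<sigma>. \<sigma> permutes {1..n} \<and> ?ct \<sigma> = c}) * G c)"
    proof (intro sum.cong refl)
      fix c assume "c \<in> C"
      then show "(\<Sum>\<sigma>\<in>{\<sigma> \<in> short. ?ct \<sigma> = c}. G (?ct \<sigma>)) =
          real (card {\<sigma>. \<sigma> permutes {1..n} \<and> ?ct \<sigma> = c}) * G c"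
        unfolding fiber[OF \<open>c \<in> C\<close>] by simp
    qed
    also have "\<dots> = (\<Sum>c\<in>C. fact n * ?w c * G c)"
    proof (intro sum.cong refl)
      fix c assume "c \<in> C"
      then have "real (card {\<sigma>. \<sigma> permutes {1..n} \<and> ?ct \<sigma> = c}) = fact n * ?w c"
        by (subst count_cycle_type[of _ N]) (auto simp: C_def total_def)
      then show "real (card {\<sigma>. \<sigma> permutes {1..n} \<and> ?ct \<sigma> = c}) * G c = fact n * ?w c * G c" by simp
    qed
    finally show ?thesis by (simp add: sum_distrib_left mult_ac)
  qed
  have sum_law: "measure_pmf.expectation law (\<lambda>c. G c * of_bool (total c = n)) = K * (\<Sum>c\<in>C. G c * ?w c)"
    for G :: "_ \<Rightarrow> real"
  proof -
    have "measure_pmf.expectation law (\<lambda>c. G c * of_bool (total c = n)) =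
      (\<Sum>c\<in>C. pmf law c *\<^sub>R (G c * of_bool (total c = n)))"
    proof (rule integral_measure_pmf[OF finC])
      fix c assume "c \<in> set_pmf law" "G c * of_bool (total c = n) \<noteq> 0"
      then show "c \<in> C"
        using set_Pi_pmf_subset[of "{1..N}" 0 "\<lambda>j. poisson_pmf (mu j)"] unfolding law_def C_def by auto
    qed
    also have "\<dots> = (\<Sum>c\<in>C. K * (G c * ?w c))"
    proof (intro sum.cong refl)
      fix c assume c: "c \<in> C"
      have "pmf law c = (\<Prod>j\<in>{1..N}. pmf (poisson_pmf (mu j)) (c j))"
        unfolding law_def using c by (intro pmf_Pi') (auto simp: C_def)
      also have "\<dots> = (\<Prod>j\<in>{1..N}. (1 / (real j ^ c j * fact (c j))) * (x ^ (j * c j) * exp (- mu j)))"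
        using mu_pos by (intro prod.cong refl)
          (simp add: mu_def power_divide power_mult[symmetric] field_simps)
      also have "\<dots> = ?w c * (x ^ (\<Sum>j=1..N. j * c j) * exp (\<Sum>j=1..N. - mu j))"
        by (simp only: prod.distrib cauchy_weight_def power_sum exp_sum finite_atLeastAtMost)
      also have "\<dots> = ?w c * K"
        using c by (simp add: C_def K_def total_def sum_negf)
      finally show "pmf law c *\<^sub>R (G c * of_bool (total c = n)) = K * (G c * ?w c)"
        using c by (simp add: C_def)
    qed
    finally show ?thesis by (simp add: sum_distrib_left)
  qed
  have "measure_pmf.expectation (pmf_of_set short) (\<lambda>\<sigma>. F (?ct \<sigma>)) = (\<Sum>\<sigma>\<in>short. F (?ct \<sigma>)) / real (card short)"
    using ne finS by (subst integral_pmf_of_set) auto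
  also have "real (card short) = (\<Sum>\<sigma>\<in>short. 1)" by simp
  also have "(\<Sum>\<sigma>\<in>short. F (?ct \<sigma>)) / (\<Sum>\<sigma>\<in>short. 1) = (\<Sum>c\<in>C. F c * ?w c) / (\<Sum>c\<in>C. 1 * ?w c)"
    unfolding sum_short[of F] sum_short[of "\<lambda>_. 1"] by simp
  also have "\<dots> = (K * (\<Sum>c\<in>C. F c * ?w c)) / (K * (\<Sum>c\<in>C. 1 * ?w c))"
    using K by simp
  also have "\<dots> = measure_pmf.expectation law (\<lambda>c. F c * of_bool (total c = n)) / hit"
    unfolding sum_law[symmetric] by simp
  finally show ?thesis .
qed

end

section \<open>Comparison of the conditioned and the unconditioned law\<close>

context saddle
begin

text \<open>For \<open>|t| \<le> 1 / N\<close> all the angles \<open>t * j\<close> are at most 1, where \<open>1 - cos y\<close> is comparable to \<open>y\<^sup>2\<close>. Leaving out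
the coordinates in \<open>M\<close> costs at most half of the variance.\<close>

lemma expon_near_zero:
  assumes M: "M \<subseteq> {1..N}" and t: "\<bar>t\<bar> * real N \<le> 1" and small: "var M \<le> var {1..N} / 2"
  shows "var {1..N} / 8 * t\<^sup>2 \<le> expon ({1..N} - M) t"
proof -
  have "var {1..N} = var M + var ({1..N} - M)"
    unfolding var_def using M by (subst sum.subset_diff[of M]) auto
  then have "var {1..N} / 8 * t\<^sup>2 \<le> var ({1..N} - M) / 4 * t\<^sup>2"
    using small by (intro mult_right_mono) auto
  also have "\<dots> = (\<Sum>j\<in>{1..N} - M. mu j * ((t * j)\<^sup>2 / 4))"
    unfolding var_def sum_distrib_right sum_divide_distrib
    by (intro sum.cong) (auto simp: power_mult_distrib)
  also have "\<dots> \<le> expon ({1..N} - M) t"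
    unfolding expon_def
  proof (intro sum_mono mult_left_mono mu_nonneg one_minus_cos_ge)
    fix j assume "j \<in> {1..N} - M"
    then have "\<bar>t\<bar> * real j \<le> \<bar>t\<bar> * real N" by (intro mult_left_mono) auto
    then show "\<bar>t * real j\<bar> \<le> 1" using t by (simp add: abs_mult)
  qed
  finally show ?thesis .
qed

text \<open>Dividing the covariance bound, of order \<open>sqrt (var M) / \<sigma>\<^sup>2\<close>, by the probability of the conditioning
event, of order \<open>1 / \<sigma>\<close>, leaves \<open>sqrt (var M) / \<sigma>\<close>: conditioning on the total does not affect a
set of coordinates that contributes a negligible part of the variance of the total.\<close>

lemma short_expectation_close_to_law:
  fixes F :: "(nat \<Rightarrow> nat) \<Rightarrow> real"
  assumes N: "1 \<le> N" and ne: "short \<noteq> {}" and M: "M \<subseteq> {1..N}"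
    and F: "\<And>c c'. (\<And>j. j \<in> M \<Longrightarrow> c j = c' j) \<Longrightarrow> F c = F c'" "\<And>c. \<bar>F c\<bar> \<le> B"
    and small: "var M \<le> var {1..N} / 2"
    and far: "\<And>t. 1 / real N \<le> \<bar>t\<bar> \<Longrightarrow> \<bar>t\<bar> \<le> pi \<Longrightarrow> L \<le> expon ({1..N} - M) t"
    and L: "2 * pi\<^sup>2 * exp (- L) \<le> 1 / var {1..N}"
    and large: "2000000 * real N \<le> sqrt (var {1..N})"
  shows "\<bar>measure_pmf.expectation (pmf_of_set short) (\<lambda>\<sigma>. F (cycle_type {1..n} \<sigma>)) - measure_pmf.expectation law F\<bar>
     \<le> 18 * B * sqrt (var M / var {1..N})"
proof -
  define s where "s = sqrt (var {1..N})"
  have "1 \<le> real N" using N by simp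
  then have s: "0 < s" "s\<^sup>2 = var {1..N}"
    using large var_nonneg unfolding s_def by (linarith, simp)
  have B: "0 \<le> B" using F(2)[of undefined] by linarith
  have decay: "exp (- expon ({1..N} - M) t) \<le> exp (- (s\<^sup>2 / 8) * t\<^sup>2) + exp (- L)" if t: "\<bar>t\<bar> \<le> pi" for t
  proof (cases "\<bar>t\<bar> * real N \<le> 1")
    case True
    have "exp (- expon ({1..N} - M) t) \<le> exp (- (s\<^sup>2 / 8) * t\<^sup>2)"
      using expon_near_zero[OF M True small] s by simp
    then show ?thesis using exp_ge_zero[of "-L"] by linarith
  next
    case False
    then have "1 / real N \<le> \<bar>t\<bar>" using N by (simp add: field_simps)
    then have "exp (- expon ({1..N} - M) t) \<le> exp (- L)" using far t by simp
    then show ?thesis using exp_ge_zero[of "- (s\<^sup>2 / 8) * t\<^sup>2"] by linarith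
  qed
  have L': "2 * pi\<^sup>2 * exp (- L) \<le> 1 / s\<^sup>2" using L s by simp
  have moment: "(LINT t|unit_circle_measure. \<bar>t\<bar> * exp (- expon ({1..N} - M) t)) \<le> 9 / s\<^sup>2"
  proof -
    have "(LINT t|unit_circle_measure. \<bar>t\<bar> * exp (- expon ({1..N} - M) t)) \<le> 1 / (s\<^sup>2 / 8) + 2 * pi\<^sup>2 * exp (- L)"
    proof (rule integral_first_moment_bound)
      show "0 < s\<^sup>2 / 8" using s(1) by simp
    qed (use decay in \<open>auto intro!: continuous_intros continuous_on_expon\<close>)
    then show ?thesis using L' by simp
  qed
  have hit: "1 / (4 * pi * s) \<le> hit"
  proof (rule hit_lower_bound[OF N _ s _ L'])
    fix t :: real assume t: "\<bar>t\<bar> \<le> pi"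
    have "expon ({1..N} - M) t \<le> expon {1..N} t"
      unfolding expon_def using mu_nonneg by (intro sum_mono2) auto
    then have "exp (- expon {1..N} t) \<le> exp (- expon ({1..N} - M) t)" by simp
    then show "exp (- expon {1..N} t) \<le> exp (- (s\<^sup>2 / 8) * t\<^sup>2) + exp (- L)"
      using decay[OF t] by linarith
  qed (use large s_def in auto)
  have hit_pos: "0 < hit" by (rule less_le_trans[OF _ hit]) (use s in simp)
  let ?D = "measure_pmf.expectation law (\<lambda>c. F c * of_bool (total c = n)) - measure_pmf.expectation law F * hit"
  have eq: "measure_pmf.expectation (pmf_of_set short) (\<lambda>\<sigma>. F (cycle_type {1..n} \<sigma>)) - measure_pmf.expectation law F = ?D / hit"
    unfolding expectation_short_conditioning[OF ne] using hit_pos by (simp add: field_simps)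
  have "\<bar>?D / hit\<bar> = \<bar>?D\<bar> / hit" using hit_pos by simp
  also have "\<dots> \<le> (B * sqrt (var M) / (2 * pi) * (9 / s\<^sup>2)) / (1 / (4 * pi * s))"
  proof (rule frac_le)
    have "\<bar>?D\<bar> \<le> B * sqrt (var M) / (2 * pi) * (LINT t|unit_circle_measure. \<bar>t\<bar> * exp (- expon ({1..N} - M) t))"
      by (rule hit_covariance_bound[OF M, of F B]) (fact F)+
    also have "\<dots> \<le> B * sqrt (var M) / (2 * pi) * (9 / s\<^sup>2)"
      using moment B var_nonneg by (intro mult_left_mono) auto
    finally show "\<bar>?D\<bar> \<le> B * sqrt (var M) / (2 * pi) * (9 / s\<^sup>2)" .
  qed (use hit s B var_nonneg in auto)
  also have "\<dots> = 18 * B * (sqrt (var M) / s)"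
    using s(1) by (simp add: field_simps power2_eq_square)
  also have "sqrt (var M) / s = sqrt (var M / var {1..N})"
    by (simp add: s_def real_sqrt_divide)
  finally show ?thesis unfolding eq .
qed

text \<open>The lower bound is Chebyshev's sum inequality: for \<open>x \<ge> 1\<close> both \<open>j\<close> and \<open>x ^ j\<close> increase, so the average
of \<open>j * x ^ j\<close> is at least the product of the averages.\<close>

lemma var_bounds:
  assumes N: "1 \<le> N"
  shows "real n * real N / 2 \<le> var {1..N} \<or> x < 1" and "var {1..N} \<le> real n * real N"
    and "1 \<le> x \<Longrightarrow> M \<subseteq> {1..N} \<Longrightarrow> var M \<le> real (card M) * (real N * x ^ N)"
proof -
  have v: "var M = (\<Sum>j\<in>M. real j * x ^ j)" if "M \<subseteq> {1..N}" for M
    unfolding var_def using that by (intro sum.cong) (auto simp: mu_def power2_eq_square)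
  show "real n * real N / 2 \<le> var {1..N} \<or> x < 1"
  proof (cases "1 \<le> x")
    case True
    have "(\<Sum>k=0..<N. real (Suc k)) * (\<Sum>k=0..<N. x ^ Suc k) \<le> real N * (\<Sum>k=0..<N. real (Suc k) * x ^ Suc k)"
    proof -
      have "real N * (\<Sum>k=0..<N. real (Suc k) * (- (x ^ Suc k))) \<le> (\<Sum>k=0..<N. real (Suc k)) * (\<Sum>k=0..<N. - (x ^ Suc k))"
      proof (rule Chebyshev_sum_upper)
        fix i j :: nat assume "i \<le> j"
        then show "- (x ^ Suc j) \<le> - (x ^ Suc i)" using True by (intro le_imp_neg_le power_increasing) auto
      qed auto
      then show ?thesis by (simp only: mult_minus_right sum_negf neg_le_iff_le)
    qed
    also have "(\<Sum>k=0..<N. real (Suc k)) = real N * (real N + 1) / 2"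
      by (induction N) (auto simp: field_simps)
    also have "(\<Sum>k=0..<N. x ^ Suc k) = (\<Sum>j=1..N. x ^ j)"
      by (intro sum.reindex_bij_witness[of _ "\<lambda>j. j - 1" Suc]) auto
    also have "(\<Sum>k=0..<N. real (Suc k) * x ^ Suc k) = (\<Sum>j=1..N. real j * x ^ j)"
      by (intro sum.reindex_bij_witness[of _ "\<lambda>j. j - 1" Suc]) auto
    finally have "real N * ((real N + 1) / 2 * real n) \<le> real N * var {1..N}"
      unfolding saddle_eq v[OF order_refl] by simp
    then have "(real N + 1) / 2 * real n \<le> var {1..N}" using N by simp
    moreover have "real n * real N / 2 \<le> (real N + 1) / 2 * real n" by (simp add: field_simps)
    ultimately show ?thesis by linarith
  qed auto
  show "var {1..N} \<le> real n * real N"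
  proof -
    have "var {1..N} \<le> (\<Sum>j=1..N. real N * x ^ j)"
      unfolding v[OF order_refl] using x_pos by (intro sum_mono mult_right_mono) auto
    then show ?thesis unfolding sum_distrib_left[symmetric] saddle_eq by (simp only: mult.commute)
  qed
  show "var M \<le> real (card M) * (real N * x ^ N)" if x1: "1 \<le> x" and M: "M \<subseteq> {1..N}"
    unfolding v[OF M]
  proof (rule sum_bounded_above)
    fix j assume "j \<in> M"
    then show "real j * x ^ j \<le> real N * x ^ N"
      using M x1 by (intro mult_mono power_increasing) auto
  qed
qed

text \<open>The saddle point is only slightly larger than 1. From \<open>x ^ N \<le> n\<close> follows \<open>x - 1 \<le> 2 * ln n / N\<close>, and
the geometric sum then shows that even the largest term \<open>x ^ N\<close> is only a fraction of about \<open>2 * ln n / N\<close> of \<open>n\<close>.\<close>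

lemma saddle_estimates:
  assumes N: "1 \<le> N" and Nn: "2 * N \<le> n" and ln: "ln (real n) \<le> real N"
  shows "1 < x" and "x - 1 \<le> 2 * ln (real n) / real N"
    and "x ^ N / real n \<le> 1 / real n + 2 * ln (real n) / real N"
    and "real n / real N \<le> x ^ N"
    and "(x - 1) * real n = x * (x ^ N - 1)"
proof -
  have n: "1 < n" using N Nn by linarith
  show x1: "1 < x"
  proof (rule ccontr)
    assume "\<not> 1 < x"
    then have "(\<Sum>j=1..N. x ^ j) \<le> (\<Sum>j=1..N. 1)"
      using x_pos by (intro sum_mono power_le_one) auto
    then show False using saddle_eq Nn N by simp
  qed
  have "x ^ N \<le> (\<Sum>j=1..N. x ^ j)" using N x_pos by (intro member_le_sum) auto
  then have "ln (x ^ N) \<le> ln (real n)" using saddle_eq x_pos n by simp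
  then have u: "ln x \<le> ln (real n) / real N" using N x_pos by (simp add: ln_realpow field_simps)
  define u where "u = ln (real n) / real N"
  have u01: "0 \<le> u" "u \<le> 1" using ln N n by (auto simp: u_def)
  have "x \<le> exp u" using u x_pos unfolding u_def[symmetric] by (metis exp_le_cancel_iff exp_ln)
  also have "\<dots> \<le> 1 + u + u\<^sup>2" using u01 by (rule exp_bound)
  also have "u\<^sup>2 \<le> u" using u01 by (simp add: power2_eq_square mult_left_le)
  finally show l: "x - 1 \<le> 2 * ln (real n) / real N" by (simp add: u_def)
  show geo: "(x - 1) * real n = x * (x ^ N - 1)"
  proof -
    have "(x - 1) * (\<Sum>j=1..N. x ^ j) = x * (x ^ N - 1)"
      by (induction N) (auto simp: algebra_simps)
    then show ?thesis by (simp only: saddle_eq)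
  qed
  have "1 * (x ^ N - 1) \<le> x * (x ^ N - 1)" using x1 by (intro mult_right_mono) auto
  then have "x ^ N \<le> 1 + (x - 1) * real n" unfolding geo by simp
  then have "x ^ N / real n \<le> (1 + (x - 1) * real n) / real n" using n by (intro divide_right_mono) auto
  also have "\<dots> = 1 / real n + (x - 1)" using n by (simp add: add_divide_distrib)
  finally show "x ^ N / real n \<le> 1 / real n + 2 * ln (real n) / real N" using l by linarith
  have "(\<Sum>j=1..N. x ^ j) \<le> (\<Sum>j=1..N. x ^ N)"
    using x1 by (intro sum_mono power_increasing) auto
  then have "real n \<le> real N * x ^ N" using saddle_eq by simp
  then show "real n / real N \<le> x ^ N" using N by (simp add: field_simps)
qed

text \<open>With \<open>z = x * cis t\<close>, the geometric sums of \<open>z\<close> and of \<open>x\<close> differ in modulus essentially by the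
factor \<open>(x - 1) / |z - 1|\<close>. As \<open>x - 1\<close> is of order at most \<open>ln n / N\<close> while \<open>|t| \<ge> 1 / N\<close>, this factor stays below 1
by an amount of order \<open>1 / (ln n)\<^sup>2\<close>.\<close>

lemma power_sum_off_axis:
  assumes N: "1 \<le> N" and Nn: "2 * N \<le> n" and n3: "3 \<le> n" and ln: "ln (real n) \<le> real N"
    and t: "1 / real N \<le> \<bar>t\<bar>" "\<bar>t\<bar> \<le> pi"
  shows "(\<Sum>j=1..N. x ^ j * cos (t * j)) \<le> real n * (1 - 1 / (32 * (ln (real n))\<^sup>2) + 4 * real N / real n)"
proof -
  note est = saddle_estimates[OF N Nn ln]
  define lam where "lam = x - 1"
  define z where "z = of_real x * cis t"
  \<comment> \<open>a lower bound of \<open>(|z - 1| / (x - 1))\<^sup>2 - 1\<close>, see the estimate of \<open>norm (z - 1)\<close> below\<close>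
  define \<delta> where "\<delta> = 1 / (8 * (ln (real n))\<^sup>2)"
  have lam: "0 < lam" using est(1) by (simp add: lam_def)
  have ln1: "1 \<le> ln (real n)"
  proof -
    have "exp 1 \<le> (3::real)" by (rule exp_le)
    then show ?thesis using n3 by (simp add: ln_ge_iff)
  qed
  then have \<delta>: "0 < \<delta>" "\<delta> \<le> 1" unfolding \<delta>_def by (auto simp: divide_le_eq intro: order_trans[OF _ mult_mono[of 1 8 1 "(ln (real n))\<^sup>2"]])
  have cos_t: "1 / (4 * (real N)\<^sup>2) \<le> 1 - cos t"
  proof -
    have "1 / (4 * (real N)\<^sup>2) = (1 / real N)\<^sup>2 / 4" by (simp add: power_divide)
    also have "\<dots> \<le> 1 - cos (1 / real N)" using N by (intro one_minus_cos_ge) auto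
    also have "\<dots> \<le> 1 - cos \<bar>t\<bar>" using t by (intro diff_left_mono cos_monotone_0_pi_le) auto
    finally show ?thesis by simp
  qed
  have z1: "(norm (z - 1))\<^sup>2 = lam\<^sup>2 + 2 * x * (1 - cos t)"
  proof -
    have "(norm (z - 1))\<^sup>2 = (x * cos t - 1)\<^sup>2 + (x * sin t)\<^sup>2"
      unfolding cmod_power2 z_def by simp
    also have "\<dots> = x\<^sup>2 * ((cos t)\<^sup>2 + (sin t)\<^sup>2) + 1 - 2 * x * cos t"
      by (simp only: power2_eq_square) (simp only: algebra_simps)
    finally have "(norm (z - 1))\<^sup>2 = x\<^sup>2 + 1 - 2 * x * cos t" by (simp add: sin_cos_squared_add2)
    then show ?thesis by (simp add: lam_def power2_eq_square algebra_simps)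
  qed
  have z2: "lam\<^sup>2 * (1 + \<delta>) \<le> (norm (z - 1))\<^sup>2"
  proof -
    have "lam * real N \<le> 2 * ln (real n)" using est(2) N by (simp add: lam_def field_simps)
    then have "(lam * real N)\<^sup>2 \<le> (2 * ln (real n))\<^sup>2" using lam by (intro power_mono) auto
    then have "lam\<^sup>2 * (real N)\<^sup>2 \<le> 4 * (ln (real n))\<^sup>2" by (simp add: power_mult_distrib)
    then have "lam\<^sup>2 * \<delta> \<le> 1 / (2 * (real N)\<^sup>2)" using ln1 N by (simp add: \<delta>_def field_simps)
    also have "\<dots> = 2 * 1 * (1 / (4 * (real N)\<^sup>2))" by simp
    also have "\<dots> \<le> 2 * x * (1 - cos t)" using cos_t est(1) by (intro mult_mono) auto
    finally show ?thesis unfolding z1 by (simp add: algebra_simps)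
  qed
  have z3: "lam \<le> (1 - \<delta> / 4) * norm (z - 1)"
  proof (rule power2_le_imp_le)
    have "1 \<le> (1 - \<delta> / 4)\<^sup>2 * (1 + \<delta>)"
    proof -
      have "(1 - \<delta> / 4)\<^sup>2 * (1 + \<delta>) - 1 = \<delta> / 2 * (1 - \<delta>) + \<delta> * \<delta> / 16 + \<delta> ^ 3 / 16"
        by (simp add: power2_eq_square power3_eq_cube field_simps)
      moreover have "0 \<le> \<delta> / 2 * (1 - \<delta>) + \<delta> * \<delta> / 16 + \<delta> ^ 3 / 16" using \<delta> by simp
      ultimately show ?thesis by linarith
    qed
    then have "lam\<^sup>2 * 1 \<le> lam\<^sup>2 * ((1 - \<delta> / 4)\<^sup>2 * (1 + \<delta>))" by (intro mult_left_mono) auto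
    also have "\<dots> = (1 - \<delta> / 4)\<^sup>2 * (lam\<^sup>2 * (1 + \<delta>))" by (simp add: mult_ac)
    also have "\<dots> \<le> (1 - \<delta> / 4)\<^sup>2 * (norm (z - 1))\<^sup>2" using z2 by (intro mult_left_mono) auto
    finally show "lam\<^sup>2 \<le> ((1 - \<delta> / 4) * norm (z - 1))\<^sup>2" by (simp add: power_mult_distrib)
  qed (use \<delta> in auto)
  have znorm: "norm z = x" using x_pos by (simp add: z_def norm_mult)
  have pos: "0 < norm (z - 1)"
  proof (rule ccontr)
    assume "\<not> 0 < norm (z - 1)"
    then have "norm (z - 1) = 0" by (simp only: zero_less_norm_iff norm_eq_zero not_not)
    then show False using z3 lam by simp
  qed
  have "(z - 1) * (\<Sum>j=1..N. z ^ j) = z * (z ^ N - 1)"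
    by (induction N) (auto simp: algebra_simps)
  then have "norm (z - 1) * norm (\<Sum>j=1..N. z ^ j) = norm z * norm (z ^ N - 1)"
    by (metis norm_mult)
  also have "\<dots> \<le> x * (x ^ N + 1)"
    using norm_triangle_ineq4[of "z ^ N" 1] x_pos by (auto simp: znorm norm_power intro!: mult_left_mono)
  also have "\<dots> \<le> (1 + 4 * real N / real n) * (lam * real n)"
  proof -
    have "2 \<le> real n / real N" using Nn N by (simp add: field_simps)
    moreover have "y \<le> 2 * (X - 1)" if "2 \<le> y" "y \<le> X" for X y :: real using that by simp
    ultimately have "real n / real N \<le> 2 * (x ^ N - 1)" using est(4) by blast
    then have "1 \<le> (x ^ N - 1) * (2 * real N / real n)" using N n3 by (simp add: field_simps)
    moreover have "X + 1 \<le> (1 + 2 * q) * (X - 1)" if "1 \<le> (X - 1) * q" for X q :: real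
      using that by (simp add: algebra_simps)
    ultimately have "x ^ N + 1 \<le> (1 + 2 * (2 * real N / real n)) * (x ^ N - 1)" by blast
    then have "x ^ N + 1 \<le> (1 + 4 * real N / real n) * (x ^ N - 1)" by simp
    then have "x * (x ^ N + 1) \<le> x * ((1 + 4 * real N / real n) * (x ^ N - 1))"
      using x_pos by (intro mult_left_mono) auto
    also have "\<dots> = (1 + 4 * real N / real n) * (lam * real n)" unfolding lam_def est(5) by (simp add: mult_ac)
    finally show ?thesis .
  qed
  also have "\<dots> \<le> (1 + 4 * real N / real n) * (((1 - \<delta> / 4) * norm (z - 1)) * real n)"
    using z3 by (intro mult_left_mono mult_right_mono) auto
  finally have "norm (z - 1) * norm (\<Sum>j=1..N. z ^ j) \<le> norm (z - 1) * (real n * ((1 + 4 * real N / real n) * (1 - \<delta> / 4)))"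
    by (simp add: mult_ac)
  then have "norm (\<Sum>j=1..N. z ^ j) \<le> real n * ((1 + 4 * real N / real n) * (1 - \<delta> / 4))"
    using pos by (simp only: mult_le_cancel_left_pos)
  also have "\<dots> \<le> real n * (1 - \<delta> / 4 + 4 * real N / real n)"
  proof (rule mult_left_mono)
    have "(1 + c) * (1 - d) \<le> 1 - d + c" if "0 \<le> c" "0 \<le> d" for c d :: real
      using that by (simp add: algebra_simps)
    then show "(1 + 4 * real N / real n) * (1 - \<delta> / 4) \<le> 1 - \<delta> / 4 + 4 * real N / real n"
      using \<delta> by simp
  qed simp
  finally have 1: "norm (\<Sum>j=1..N. z ^ j) \<le> real n * (1 - \<delta> / 4 + 4 * real N / real n)" .
  have "(\<Sum>j=1..N. x ^ j * cos (t * j)) = Re (\<Sum>j=1..N. z ^ j)"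
    by (auto simp: z_def power_mult_distrib Complex.DeMoivre mult.commute of_real_power[symmetric] simp del: of_real_power intro!: sum.cong)
  also have "\<dots> \<le> norm (\<Sum>j=1..N. z ^ j)" by (rule complex_Re_le_cmod)
  also note 1
  also have "\<delta> / 4 = 1 / (32 * (ln (real n))\<^sup>2)" by (simp add: \<delta>_def)
  finally show ?thesis .
qed

text \<open>Since \<open>mu j \<ge> x ^ j / N\<close>, the exponent is at least \<open>1 / N\<close> times \<open>\<Sum>j. x ^ j * (1 - cos (t * j))\<close>, and the sum over
all \<open>j\<close> is \<open>n\<close> minus the real part of a geometric sum. The terms with \<open>j \<in> M\<close> are subtracted at the price of
\<open>2 * x ^ N\<close> each.\<close>

lemma expon_away_from_zero:
  assumes N: "1 \<le> N" and Nn: "2 * N \<le> n" and n3: "3 \<le> n" and ln: "ln (real n) \<le> real N"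
    and M: "M \<subseteq> {1..N}" and t: "1 / real N \<le> \<bar>t\<bar>" "\<bar>t\<bar> \<le> pi"
  shows "real n / real N * (1 / (32 * (ln (real n))\<^sup>2) - 4 * real N / real n
      - 2 * real (card M) * (1 / real n + 2 * ln (real n) / real N)) \<le> expon ({1..N} - M) t"
proof -
  note est = saddle_estimates[OF N Nn ln]
  define R where "R = (\<Sum>j\<in>{1..N} - M. x ^ j * (1 - cos (t * j)))"
  have "(\<Sum>j=1..N. x ^ j * (1 - cos (t * j))) = R + (\<Sum>j\<in>M. x ^ j * (1 - cos (t * j)))"
    unfolding R_def using M by (intro sum.subset_diff) auto
  also have "(\<Sum>j\<in>M. x ^ j * (1 - cos (t * j))) \<le> real (card M) * (x ^ N * 2)"
  proof (rule sum_bounded_above)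
    fix j assume "j \<in> M"
    moreover have "1 - cos (t * j) \<le> 2" using cos_ge_minus_one[of "t * j"] by linarith
    ultimately show "x ^ j * (1 - cos (t * real j)) \<le> x ^ N * 2"
      using M est(1) by (intro mult_mono power_increasing) auto
  qed
  also have "real (card M) * (x ^ N * 2) = real n * (2 * real (card M) * (x ^ N / real n))"
    using n3 by simp
  also have "\<dots> \<le> real n * (2 * real (card M) * (1 / real n + 2 * ln (real n) / real N))"
    using est(3) by (intro mult_left_mono) auto
  finally have 1: "(\<Sum>j=1..N. x ^ j * (1 - cos (t * j))) \<le> R + real n * (2 * real (card M) * (1 / real n + 2 * ln (real n) / real N))"
    by simp
  have "(\<Sum>j=1..N. x ^ j * (1 - cos (t * j))) = real n - (\<Sum>j=1..N. x ^ j * cos (t * j))"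
    unfolding saddle_eq[symmetric] by (simp add: right_diff_distrib sum_subtractf)
  moreover have "n' * (p - q - r) \<le> R" if "S \<le> R + n' * r" "C \<le> n' * (1 - p + q)" "S = n' - C"
    for n' p q r S C :: real
    using that by (simp add: algebra_simps)
  ultimately have "real n * (1 / (32 * (ln (real n))\<^sup>2) - 4 * real N / real n
      - 2 * real (card M) * (1 / real n + 2 * ln (real n) / real N)) \<le> R"
    using 1 power_sum_off_axis[OF N Nn n3 ln t] by blast
  then have "(real n * (1 / (32 * (ln (real n))\<^sup>2) - 4 * real N / real n
      - 2 * real (card M) * (1 / real n + 2 * ln (real n) / real N))) / real N \<le> R / real N"
    by (rule divide_right_mono) simp
  also have "R / real N \<le> expon ({1..N} - M) t"
    unfolding R_def expon_def sum_divide_distrib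
  proof (intro sum_mono)
    fix j assume j: "j \<in> {1..N} - M"
    have "x ^ j / real N * (1 - cos (t * real j)) \<le> mu j * (1 - cos (t * real j))"
      unfolding mu_def using j x_pos by (intro mult_right_mono divide_left_mono) auto
    then show "x ^ j * (1 - cos (t * real j)) / real N \<le> mu j * (1 - cos (t * real j))" by simp
  qed
  finally show ?thesis by (simp only: times_divide_eq_left)
qed

end

section \<open>Asymptotics\<close>

text \<open>Powers of \<open>n\<close> beat powers of \<open>ln n\<close>. In the last two properties, \<open>n / n powr a2\<close> stands for
\<open>n / N\<close>, and the bracket is the one in \<open>expon_away_from_zero\<close> with the extreme values of \<open>N\<close> inserted; it
is dominated by its first term.\<close>

lemma growth_conditions:
  fixes a1 a2 k :: real
  assumes a: "0 < a1" "a1 < 1" "0 < a2" "a2 < 1" and k: "0 \<le> k"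
  defines "err \<equiv> \<lambda>n. 2 * k * (1 / real n + 4 * ln (real n) / real n powr a1)"
  shows "eventually (\<lambda>n. 2 \<le> real n powr a1) sequentially"
    and "eventually (\<lambda>n. ln (real n) \<le> real n powr a1 / 2) sequentially"
    and "eventually (\<lambda>n. 8000000000000 * real n powr a2 \<le> real n) sequentially"
    and "err \<longlonglongrightarrow> 0"
    and "eventually (\<lambda>n. 0 \<le> 1 / (32 * (ln (real n))\<^sup>2) - 4 * (real n powr a2 / real n) - err n) sequentially"
    and "eventually (\<lambda>n. 4 * ln (real n) \<le> real n / real n powr a2 *
       (1 / (32 * (ln (real n))\<^sup>2) - 4 * (real n powr a2 / real n) - err n)) sequentially"
proof -
  show "eventually (\<lambda>n. 2 \<le> real n powr a1) sequentially" using a by real_asymp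
  show "eventually (\<lambda>n. ln (real n) \<le> real n powr a1 / 2) sequentially" using a by real_asymp
  show "eventually (\<lambda>n. 8000000000000 * real n powr a2 \<le> real n) sequentially" using a by real_asymp
  have 1: "(\<lambda>n. 1 / real n + 4 * ln (real n) / real n powr a1) \<longlonglongrightarrow> 0" using a by real_asymp
  then show "err \<longlonglongrightarrow> 0" unfolding err_def by (rule tendsto_mult_right_zero)
  \<comment> \<open>the bracket, normalized so that it converges to \<open>1 / 32\<close>\<close>
  define h where "h n = (1 / (32 * (ln (real n))\<^sup>2) - 4 * (real n powr a2 / real n) - err n) * (ln (real n))\<^sup>2" for n :: nat
  have "(\<lambda>n. (1 / (32 * (ln (real n))\<^sup>2) - 4 * (real n powr a2 / real n)) * (ln (real n))\<^sup>2) \<longlonglongrightarrow> 1 / 32"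
    using a by real_asymp
  moreover have "(\<lambda>n. (1 / real n + 4 * ln (real n) / real n powr a1) * (ln (real n))\<^sup>2) \<longlonglongrightarrow> 0" using a by real_asymp
  then have "(\<lambda>n. 2 * k * ((1 / real n + 4 * ln (real n) / real n powr a1) * (ln (real n))\<^sup>2)) \<longlonglongrightarrow> 0"
    by (rule tendsto_mult_right_zero)
  ultimately have "(\<lambda>n. (1 / (32 * (ln (real n))\<^sup>2) - 4 * (real n powr a2 / real n)) * (ln (real n))\<^sup>2
      - 2 * k * ((1 / real n + 4 * ln (real n) / real n powr a1) * (ln (real n))\<^sup>2)) \<longlonglongrightarrow> 1 / 32 - 0"
    by (rule tendsto_diff)
  then have "h \<longlonglongrightarrow> 1 / 32"
    unfolding h_def[abs_def] err_def by (simp only: left_diff_distrib mult.assoc diff_zero)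
  then have h: "eventually (\<lambda>n. 1 / 64 < h n) sequentially"
    by (rule order_tendstoD) simp
  have big: "eventually (\<lambda>n. 4 * ln (real n) \<le> real n / real n powr a2 * (1 / 64 / (ln (real n))\<^sup>2)) sequentially"
    using a by real_asymp
  have ln_pos: "eventually (\<lambda>n. 0 < ln (real n)) sequentially" by real_asymp
  have lower: "eventually (\<lambda>n. 1 / 64 / (ln (real n))\<^sup>2 \<le> 1 / (32 * (ln (real n))\<^sup>2) - 4 * (real n powr a2 / real n) - err n) sequentially"
    using h ln_pos by eventually_elim (simp add: h_def divide_le_eq)
  show "eventually (\<lambda>n. 0 \<le> 1 / (32 * (ln (real n))\<^sup>2) - 4 * (real n powr a2 / real n) - err n) sequentially"
    using lower by eventually_elim (rule order_trans[rotated], assumption, simp)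
  show "eventually (\<lambda>n. 4 * ln (real n) \<le> real n / real n powr a2 *
       (1 / (32 * (ln (real n))\<^sup>2) - 4 * (real n powr a2 / real n) - err n)) sequentially"
    using lower big
  proof eventually_elim
    case (elim n)
    have "real n / real n powr a2 * (1 / 64 / (ln (real n))\<^sup>2) \<le> real n / real n powr a2 *
       (1 / (32 * (ln (real n))\<^sup>2) - 4 * (real n powr a2 / real n) - err n)"
      using elim(1) by (rule mult_left_mono) simp
    then show ?case using elim(2) by linarith
  qed
qed

lemma short_cycle_perms_saddle:
  assumes n: "1 \<le> n" and a: "1 \<le> \<alpha> n"
  shows "saddle (nat \<lfloor>\<alpha> n\<rfloor>) n (saddle_point \<alpha> n)"
    and "short_cycle_perms \<alpha> n = saddle.short (nat \<lfloor>\<alpha> n\<rfloor>) n"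
    and "cycle_mu \<alpha> n = saddle.mu (saddle_point \<alpha> n)"
proof -
  have J: "{j::nat. 1 \<le> j \<and> real j \<le> \<alpha> n} = {1..nat \<lfloor>\<alpha> n\<rfloor>}"
    using a by (auto simp: le_nat_iff le_floor_iff)
  have "saddle_point \<alpha> n > 0 \<and> real n = (\<Sum>j\<in>{j::nat. 1 \<le> j \<and> real j \<le> \<alpha> n}. saddle_point \<alpha> n ^ j)"
    unfolding saddle_point_def by (rule theI') (rule saddle_point_ex1[where \<alpha> = \<alpha> and n = n, OF n a])
  then show s: "saddle (nat \<lfloor>\<alpha> n\<rfloor>) n (saddle_point \<alpha> n)"
    unfolding J by unfold_locales auto
  show "short_cycle_perms \<alpha> n = saddle.short (nat \<lfloor>\<alpha> n\<rfloor>) n"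
    unfolding saddle.short_def[OF s] short_cycle_perms_def perm_cycles_def
    using a by (auto simp: le_nat_iff le_floor_iff)
  show "cycle_mu \<alpha> n = saddle.mu (saddle_point \<alpha> n)"
    by (simp add: fun_eq_iff saddle.mu_def[OF s] cycle_mu_def)
qed

text \<open>The comparison of the two laws with all hypotheses reduced to inequalities between elementary
functions of \<open>n\<close>, for \<open>N\<close> between \<open>n powr a1 / 2\<close> and \<open>n powr a2\<close>. The exponent \<open>4 * ln n\<close> away from the origin suffices
because it makes the characteristic function there of order \<open>n\<close> to the power \<open>-4\<close>, whereas the variance is at
most \<open>n * N \<le> n\<^sup>2\<close>.\<close>

lemma (in saddle) short_expectation_error:
  fixes F :: "(nat \<Rightarrow> nat) \<Rightarrow> real"
  assumes N: "real n powr a1 / 2 \<le> real N" "real N \<le> real n powr a2" "1 \<le> N"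
    and M: "M \<subseteq> {1..N}" "real (card M) \<le> k"
    and F: "\<And>c c'. (\<And>j. j \<in> M \<Longrightarrow> c j = c' j) \<Longrightarrow> F c = F c'" "\<And>c. \<bar>F c\<bar> \<le> B"
    and ne: "short \<noteq> {}" and n: "6 \<le> n"
    and g1: "ln (real n) \<le> real n powr a1 / 2"
    and g2: "8000000000000 * real n powr a2 \<le> real n"
  defines "err \<equiv> 2 * k * (1 / real n + 4 * ln (real n) / real n powr a1)"
  assumes g3: "err \<le> 1 / 2"
    and g4: "0 \<le> 1 / (32 * (ln (real n))\<^sup>2) - 4 * (real n powr a2 / real n) - err"
    and g5: "4 * ln (real n) \<le> real n / real n powr a2 *
       (1 / (32 * (ln (real n))\<^sup>2) - 4 * (real n powr a2 / real n) - err)"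
  shows "\<bar>measure_pmf.expectation (pmf_of_set short) (\<lambda>\<sigma>. F (cycle_type {1..n} \<sigma>)) - measure_pmf.expectation law F\<bar>
     \<le> 18 * B * sqrt err"
proof -
  have npos: "0 < real n powr a1" "0 < real n powr a2" "0 < real n" using n by auto
  have Np: "0 < N" using N(3) by linarith
  have ln0: "0 \<le> ln (real n)" using n by simp
  have NR: "0 < real N" using Np by (simp only: of_nat_0_less_iff)
  have q: "real n / real n powr a2 \<le> real n / real N"
    by (rule divide_left_mono[OF N(2)]) (use mult_pos_pos[OF npos(2) NR] in auto)
  have nN: "8000000000000 * real N \<le> real n" using g2 N(2) by linarith
  have "real (2 * N) \<le> real n" using nN by simp
  then have Nn: "2 * N \<le> n" by (simp only: of_nat_le_iff)
  have ln: "ln (real n) \<le> real N" using g1 N(1) by linarith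
  note est = saddle_estimates[OF N(3) Nn ln]
  have lnN: "2 * ln (real n) / real N \<le> 4 * ln (real n) / real n powr a1"
  proof -
    have "2 * ln (real n) / real N \<le> 2 * ln (real n) / (real n powr a1 / 2)"
    proof (rule divide_left_mono[OF N(1)])
      show "0 < real N * (real n powr a1 / 2)"
        by (rule mult_pos_pos) (use Np npos(1) in \<open>simp_all only: of_nat_0_less_iff half_gt_zero_iff\<close>)
    qed (use ln0 in simp)
    then show ?thesis by simp
  qed
  have k: "0 \<le> k" using M(2) of_nat_0_le_iff[of "card M"] by linarith
  have err_ge: "2 * real (card M) * (1 / real n + 2 * ln (real n) / real N) \<le> err"
    unfolding err_def using lnN M(2) k ln0 by (intro mult_mono add_mono) auto
  have x1: "1 \<le> x" using est(1) by simp
  have var_low: "real n * real N / 2 \<le> var {1..N}" using var_bounds(1)[OF N(3)] x1 by auto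
  have nN_pos: "0 < real n * real N" using npos(3) N(3) by simp
  have var_pos: "0 < var {1..N}" using var_low nN_pos by simp
  have ratio: "var M / var {1..N} \<le> err"
  proof -
    have "var M / var {1..N} \<le> (real (card M) * (real N * x ^ N)) / (real n * real N / 2)"
      using var_bounds(3)[OF N(3) x1 M(1)] var_low nN_pos var_nonneg x_pos by (intro frac_le) auto
    also have "\<dots> = 2 * real (card M) * (x ^ N / real n)" using N(3) by simp
    also have "\<dots> \<le> 2 * real (card M) * (1 / real n + 2 * ln (real n) / real N)"
      using est(3) by (intro mult_left_mono) auto
    finally show ?thesis using err_ge by linarith
  qed
  have B: "0 \<le> B" using F(2)[of undefined] by linarith
  have "\<bar>measure_pmf.expectation (pmf_of_set short) (\<lambda>\<sigma>. F (cycle_type {1..n} \<sigma>)) - measure_pmf.expectation law F\<bar>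
     \<le> 18 * B * sqrt (var M / var {1..N})"
  proof (rule short_expectation_close_to_law[OF N(3) ne M(1), of F B "4 * ln (real n)"])
    show "F c = F c'" if "\<And>j. j \<in> M \<Longrightarrow> c j = c' j" for c c' using that by (rule F(1))
    show "\<bar>F c\<bar> \<le> B" for c by (rule F(2))
    have "var M / var {1..N} \<le> 1 / 2" using ratio g3 by linarith
    then show "var M \<le> var {1..N} / 2" using var_pos by (simp add: divide_le_eq)
    show "4 * ln (real n) \<le> expon ({1..N} - M) t" if t: "1 / real N \<le> \<bar>t\<bar>" "\<bar>t\<bar> \<le> pi" for t
    proof -
      let ?b = "1 / (32 * (ln (real n))\<^sup>2) - 4 * (real n powr a2 / real n) - err"
      have "4 * real N / real n \<le> 4 * (real n powr a2 / real n)"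
        using N(2) npos by (simp add: divide_right_mono)
      then have 1: "?b \<le> 1 / (32 * (ln (real n))\<^sup>2) - 4 * real N / real n
         - 2 * real (card M) * (1 / real n + 2 * ln (real n) / real N)" using err_ge by linarith
      have "real n / real n powr a2 * ?b \<le> real n / real N * (1 / (32 * (ln (real n))\<^sup>2) - 4 * real N / real n
         - 2 * real (card M) * (1 / real n + 2 * ln (real n) / real N))"
        using 1 g4 q by (intro mult_mono) auto
      also have "\<dots> \<le> expon ({1..N} - M) t"
        using n by (intro expon_away_from_zero[OF N(3) Nn _ ln M(1) t]) auto
      finally show ?thesis using g5 by linarith
    qed
    show "2 * pi\<^sup>2 * exp (- (4 * ln (real n))) \<le> 1 / var {1..N}"
    proof -
      have "exp (- (4 * ln (real n))) = inverse (exp (real 4 * ln (real n)))" by (simp add: exp_minus)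
      also have "exp (real 4 * ln (real n)) = real n ^ 4" using npos by (subst exp_of_nat_mult) simp
      finally have e: "exp (- (4 * ln (real n))) = 1 / real n ^ 4" by (simp add: inverse_eq_divide)
      have "pi\<^sup>2 \<le> 4\<^sup>2" using pi_less_4 by (intro power_mono) auto
      then have "2 * pi\<^sup>2 \<le> 6\<^sup>2" by simp
      also have "\<dots> \<le> (real n)\<^sup>2" using n by (intro power_mono) auto
      finally have "2 * pi\<^sup>2 * (1 / real n ^ 4) \<le> (real n)\<^sup>2 * (1 / real n ^ 4)" by (intro mult_right_mono) auto
      also have "\<dots> = 1 / (real n * real n)" using npos by (simp add: power2_eq_square power4_eq_xxxx)
      also have "\<dots> \<le> 1 / (real n * real N)" using Nn N(3) npos by (intro divide_left_mono mult_left_mono) auto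
      also have "\<dots> \<le> 1 / var {1..N}" using var_bounds(2)[OF N(3)] var_pos nN_pos by (intro divide_left_mono) auto
      finally show ?thesis unfolding e .
    qed
    show "2000000 * real N \<le> sqrt (var {1..N})"
    proof (rule real_le_rsqrt)
      have "(2000000 * real N)\<^sup>2 = 8000000000000 * real N * real N / 2" by (simp add: power2_eq_square)
      also have "\<dots> \<le> real n * real N / 2" using nN by (intro divide_right_mono mult_right_mono) auto
      finally show "(2000000 * real N)\<^sup>2 \<le> var {1..N}" using var_low by linarith
    qed
  qed
  also have "\<dots> \<le> 18 * B * sqrt err" using ratio B by (intro mult_left_mono) auto
  finally show ?thesis .
qed

section \<open>Limit theorems for independent variables\<close>

definition std_poisson :: "real \<Rightarrow> real measure" where
  "std_poisson r = distr (measure_pmf (poisson_pmf r)) borel (\<lambda>k. (real k - r) / sqrt r)"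

lemma real_distribution_std_poisson: "real_distribution (std_poisson r)"
  unfolding std_poisson_def
  by (intro prob_space.real_distribution_distr measure_pmf.prob_space_axioms) simp

lemma char_std_poisson:
  assumes r: "0 < r"
  shows "char (std_poisson r) t = exp (of_real r * (cis (t / sqrt r) - 1 - \<i> * of_real (t / sqrt r)))"
proof -
  have sr: "r / sqrt r = sqrt r" using r by (simp add: real_div_sqrt)
  have "char (std_poisson r) t = measure_pmf.expectation (poisson_pmf r) (\<lambda>k. iexp (t * ((real k - r) / sqrt r)))"
    unfolding char_def std_poisson_def by (subst integral_distr) auto
  also have "(\<lambda>k. iexp (t * ((real k - r) / sqrt r))) = (\<lambda>k. cis (- t * sqrt r) * cis (t / sqrt r * real k))"
  proof
    fix k :: nat
    have "t * ((real k - r) / sqrt r) = - t * sqrt r + t / sqrt r * real k"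
      using sr by (simp add: diff_divide_distrib right_diff_distrib)
    then show "iexp (t * ((real k - r) / sqrt r)) = cis (- t * sqrt r) * cis (t / sqrt r * real k)"
      by (simp only: cis_mult) (simp only: cis_conv_exp)
  qed
  also have "measure_pmf.expectation (poisson_pmf r) (\<lambda>k. cis (- t * sqrt r) * cis (t / sqrt r * real k))
      = cis (- t * sqrt r) * exp (of_real r * (cis (t / sqrt r) - 1))"
    by (simp only: integral_mult_right_zero expectation_poisson_cis[OF r])
  also have "\<dots> = exp (of_real r * (cis (t / sqrt r) - 1) - \<i> * of_real (t * sqrt r))"
    unfolding cis_conv_exp exp_add[symmetric] by (simp add: algebra_simps)
  also have "t * sqrt r = r * (t / sqrt r)"
    by (metis sr mult.commute times_divide_eq_right)
  finally show ?thesis by (simp add: algebra_simps)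
qed

text \<open>By the approximation of \<open>cis y\<close> to second order, the exponent of the characteristic function at \<open>t\<close> is
\<open>- t\<^sup>2 / 2\<close> up to \<open>|t|^3 / (6 * sqrt r)\<close>; the claim is then Levy's continuity theorem.\<close>

lemma poisson_clt:
  assumes r: "filterlim r at_top sequentially"
  shows "weak_conv_m (\<lambda>n. std_poisson (r n)) std_normal_distribution"
proof (rule levy_continuity)
  show "real_distribution (std_poisson (r n))" for n by (rule real_distribution_std_poisson)
  show "real_distribution std_normal_distribution" by (rule real_dist_normal_dist)
  fix t :: real
  let ?w = "\<lambda>n. of_real (r n) * (cis (t / sqrt (r n)) - 1 - \<i> * of_real (t / sqrt (r n)))"
  have pos: "eventually (\<lambda>n. 0 < r n) sequentially"
    using r by (rule eventually_compose_filterlim[OF eventually_gt_at_top])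
  have "(\<lambda>n. ?w n + of_real (t\<^sup>2 / 2)) \<longlonglongrightarrow> 0"
  proof (rule Lim_null_comparison)
    show "eventually (\<lambda>n. norm (?w n + of_real (t\<^sup>2 / 2)) \<le> \<bar>t\<bar> ^ 3 / 6 * (1 / sqrt (r n))) sequentially"
      using pos
    proof eventually_elim
      case (elim n)
      let ?y = "t / sqrt (r n)"
      have "r n * (?y\<^sup>2 / 2) = t\<^sup>2 / 2" using elim by (simp add: power_divide)
      then have "complex_of_real (t\<^sup>2 / 2) = of_real (r n) * ((complex_of_real ?y)\<^sup>2 / 2)"
        by (metis of_real_divide of_real_mult of_real_numeral of_real_power)
      then have "?w n + of_real (t\<^sup>2 / 2) = of_real (r n) * (cis ?y - 1 - \<i> * of_real ?y + (complex_of_real ?y)\<^sup>2 / 2)"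
        by (simp only: distrib_left)
      also have "norm \<dots> \<le> r n * (\<bar>?y\<bar> ^ 3 / 6)"
        unfolding norm_mult norm_of_real abs_of_pos[OF elim]
        by (rule mult_left_mono[OF cis_minus_linear_bound]) (use elim in simp)
      also have "\<dots> = \<bar>t\<bar> ^ 3 / 6 * (1 / sqrt (r n))"
      proof -
        have "\<bar>?y\<bar> ^ 3 = \<bar>t\<bar> ^ 3 / (r n * sqrt (r n))"
          using elim by (simp add: power_divide power3_eq_cube abs_mult)
        then show ?thesis using elim by simp
      qed
      finally show ?case .
    qed
    have "(\<lambda>n. 1 / sqrt (r n)) \<longlonglongrightarrow> 0"
      using filterlim_compose[OF sqrt_at_top r] by (rule tendsto_divide_0[OF tendsto_const filterlim_at_top_imp_at_infinity])
    then show "(\<lambda>n. \<bar>t\<bar> ^ 3 / 6 * (1 / sqrt (r n))) \<longlonglongrightarrow> 0" by (rule tendsto_mult_right_zero)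
  qed
  then have "(\<lambda>n. (?w n + of_real (t\<^sup>2 / 2)) - of_real (t\<^sup>2 / 2)) \<longlonglongrightarrow> 0 - complex_of_real (t\<^sup>2 / 2)"
    by (intro tendsto_diff tendsto_const)
  then have "(\<lambda>n. exp (?w n)) \<longlonglongrightarrow> exp (- complex_of_real (t\<^sup>2 / 2))"
    by (intro tendsto_exp) simp
  also have "exp (- complex_of_real (t\<^sup>2 / 2)) = char std_normal_distribution t"
    unfolding char_std_normal_distribution by (simp add: exp_of_real[symmetric])
  finally show "(\<lambda>n. char (std_poisson (r n)) t) \<longlonglongrightarrow> char std_normal_distribution t"
    by (rule Lim_transform_eventually) (use pos in \<open>eventually_elim, simp add: char_std_poisson\<close>)
qed

lemma measurable_coordinatewise:
  fixes Y :: "'k::finite \<Rightarrow> 'a \<Rightarrow> real"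
  assumes Y: "\<And>j. Y j \<in> borel_measurable (\<Omega> j)"
  shows "(\<lambda>\<omega> j. Y j (\<omega> j)) \<in> measurable (PiM UNIV \<Omega>) (PiM UNIV (\<lambda>_. borel))"
proof -
  have "(\<lambda>\<omega>. Y j (\<omega> j)) \<in> borel_measurable (PiM UNIV \<Omega>)" for j
    by (rule measurable_compose[where f="\<lambda>\<omega>. \<omega> j", OF _ Y]) simp
  then have "(\<lambda>\<omega>. \<lambda>j\<in>UNIV. Y j (\<omega> j)) \<in> measurable (PiM UNIV \<Omega>) (PiM UNIV (\<lambda>_. borel))"
    by (intro measurable_restrict)
  then show ?thesis by (simp add: restrict_def)
qed

lemma PiM_distr_eq:
  fixes Y :: "'k::finite \<Rightarrow> 'a \<Rightarrow> real"
  assumes \<Omega>: "\<And>j. prob_space (\<Omega> j)" and Y: "\<And>j. Y j \<in> borel_measurable (\<Omega> j)"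
  shows "PiM UNIV (\<lambda>j. distr (\<Omega> j) borel (Y j)) = distr (PiM UNIV \<Omega>) (PiM UNIV (\<lambda>_. borel)) (\<lambda>\<omega> j. Y j (\<omega> j))"
proof -
  let ?N = "\<lambda>j. distr (\<Omega> j) borel (Y j)"
  have N: "prob_space (?N j)" for j using \<Omega> Y by (rule prob_space.prob_space_distr)
  interpret product_sigma_finite ?N
    unfolding product_sigma_finite_def using N prob_space_imp_sigma_finite by blast
  interpret O: product_sigma_finite \<Omega>
    unfolding product_sigma_finite_def using \<Omega> prob_space_imp_sigma_finite by blast
  note [measurable] = measurable_coordinatewise[OF Y]
  show ?thesis
  proof (rule PiM_eqI[symmetric])
    show "sets (distr (PiM UNIV \<Omega>) (PiM UNIV (\<lambda>_. borel)) (\<lambda>\<omega> j. Y j (\<omega> j))) = PiM UNIV ?N"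
      by (simp cong: sets_PiM_cong)
    fix A assume "\<And>i. i \<in> (UNIV :: 'k set) \<Longrightarrow> A i \<in> sets (?N i)"
    then have A: "\<And>i. A i \<in> sets borel" by simp
    have "emeasure (distr (PiM UNIV \<Omega>) (PiM UNIV (\<lambda>_. borel)) (\<lambda>\<omega> j. Y j (\<omega> j))) (Pi\<^sub>E UNIV A) =
      emeasure (PiM UNIV \<Omega>) ((\<lambda>\<omega> j. Y j (\<omega> j)) -` (Pi\<^sub>E UNIV A) \<inter> space (PiM UNIV \<Omega>))"
      using A by (intro emeasure_distr sets_PiM_I_finite) auto
    also have "(\<lambda>\<omega> j. Y j (\<omega> j)) -` (Pi\<^sub>E UNIV A) \<inter> space (PiM UNIV \<Omega>) = (\<Pi>\<^sub>E j\<in>UNIV. Y j -` A j \<inter> space (\<Omega> j))"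
      by (auto simp: space_PiM PiE_iff)
    also have "emeasure (PiM UNIV \<Omega>) \<dots> = (\<Prod>j\<in>UNIV. emeasure (\<Omega> j) (Y j -` A j \<inter> space (\<Omega> j)))"
      using A Y by (intro O.emeasure_PiM measurable_sets[OF Y]) auto
    also have "\<dots> = (\<Prod>j\<in>UNIV. emeasure (?N j) (A j))"
      using A Y by (intro prod.cong) (auto simp: emeasure_distr)
    finally show "emeasure (distr (PiM UNIV \<Omega>) (PiM UNIV (\<lambda>_. borel)) (\<lambda>\<omega> j. Y j (\<omega> j))) (Pi\<^sub>E UNIV A) = (\<Prod>i\<in>UNIV. emeasure (?N i) (A i))" .
  qed simp
qed

lemma measurable_vec_lambda_PiM [measurable]:
  "(\<lambda>x. \<chi> j. x j) \<in> measurable (PiM UNIV (\<lambda>_::'k::finite. borel)) (borel :: (real ^ 'k) measure)"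
proof (subst borel_measurable_euclidean_space, intro ballI)
  fix i :: "real ^ 'k" assume "i \<in> Basis"
  then obtain k where i: "i = axis k 1" by (auto simp: Basis_vec_def)
  show "(\<lambda>x. (\<chi> j. x j) \<bullet> i) \<in> borel_measurable (PiM UNIV (\<lambda>_. borel))"
    unfolding i inner_axis by simp
qed

text \<open>Weak convergence of the marginals carries over to finite products. Skorohod's theorem represents each
marginal sequence by a pointwise convergent one; on the product of the representing spaces the
vectors then converge pointwise, and dominated convergence applies.\<close>

lemma weak_convergence_product:
  fixes f :: "real ^ 'k::finite \<Rightarrow> real"
  assumes \<nu>: "\<And>n j. real_distribution (\<nu> n j)" and \<nu>': "\<And>j. real_distribution (\<nu>' j)"
    and conv: "\<And>j. weak_conv_m (\<lambda>n. \<nu> n j) (\<nu>' j)"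
    and f: "continuous_on UNIV f" and B: "\<And>x. \<bar>f x\<bar> \<le> B"
  shows "(\<lambda>n. \<integral>x. f (\<chi> j. x j) \<partial>PiM UNIV (\<nu> n)) \<longlonglongrightarrow> (\<integral>x. f (\<chi> j. x j) \<partial>PiM UNIV \<nu>')"
proof -
  have "\<exists>(\<Omega> :: real measure) (Y :: nat \<Rightarrow> real \<Rightarrow> real) (Y' :: real \<Rightarrow> real). prob_space \<Omega> \<and> (\<forall>n. Y n \<in> measurable \<Omega> borel) \<and> (\<forall>n. distr \<Omega> borel (Y n) = \<nu> n j) \<and>
     Y' \<in> measurable \<Omega> lborel \<and> distr \<Omega> borel Y' = \<nu>' j \<and> (\<forall>x\<in>space \<Omega>. (\<lambda>n. Y n x) \<longlonglongrightarrow> Y' x)" 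
    for j :: 'k
    using Skorohod[of "\<lambda>n. \<nu> n j" "\<nu>' j", OF \<nu> \<nu>' conv] .
  then obtain \<Omega> :: "'k \<Rightarrow> real measure" and Y Y' where *: "\<And>j. prob_space (\<Omega> j)" "\<And>j n. Y j n \<in> borel_measurable (\<Omega> j)"
     "\<And>j n. distr (\<Omega> j) borel (Y j n) = \<nu> n j" "\<And>j. Y' j \<in> measurable (\<Omega> j) lborel"
     "\<And>j. distr (\<Omega> j) borel (Y' j) = \<nu>' j" "\<And>j x. x \<in> space (\<Omega> j) \<Longrightarrow> (\<lambda>n. Y j n x) \<longlonglongrightarrow> Y' j x"
    by metis
  have Y': "Y' j \<in> borel_measurable (\<Omega> j)" for j using *(4)[of j] by simp
  have fm [measurable]: "f \<in> borel_measurable borel" using f by (rule borel_measurable_continuous_onI)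
  have comp: "(\<integral>x. f (\<chi> j. x j) \<partial>PiM UNIV (\<lambda>j. distr (\<Omega> j) borel (Z j))) = (\<integral>\<omega>. f (\<chi> j. Z j (\<omega> j)) \<partial>PiM UNIV \<Omega>)"
    and meas: "(\<lambda>\<omega>. f (\<chi> j. Z j (\<omega> j))) \<in> borel_measurable (PiM UNIV \<Omega>)"
    if Z: "\<And>j. Z j \<in> borel_measurable (\<Omega> j)" for Z
  proof -
    note Zm [measurable] = measurable_coordinatewise[OF Z]
    show "(\<integral>x. f (\<chi> j. x j) \<partial>PiM UNIV (\<lambda>j. distr (\<Omega> j) borel (Z j))) = (\<integral>\<omega>. f (\<chi> j. Z j (\<omega> j)) \<partial>PiM UNIV \<Omega>)"
      unfolding PiM_distr_eq[OF *(1) Z] by (subst integral_distr) auto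
    show "(\<lambda>\<omega>. f (\<chi> j. Z j (\<omega> j))) \<in> borel_measurable (PiM UNIV \<Omega>)"
      using measurable_compose[OF measurable_compose[OF Zm measurable_vec_lambda_PiM] fm] .
  qed
  interpret P: prob_space "PiM UNIV \<Omega>" by (intro prob_space_PiM *(1))
  have "(\<lambda>n. \<integral>\<omega>. f (\<chi> j. Y j n (\<omega> j)) \<partial>PiM UNIV \<Omega>) \<longlonglongrightarrow> (\<integral>\<omega>. f (\<chi> j. Y' j (\<omega> j)) \<partial>PiM UNIV \<Omega>)"
  proof (rule integral_dominated_convergence[where w="\<lambda>_. B"])
    show "AE \<omega> in PiM UNIV \<Omega>. (\<lambda>n. f (\<chi> j. Y j n (\<omega> j))) \<longlonglongrightarrow> f (\<chi> j. Y' j (\<omega> j))"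
    proof (rule AE_I2)
      fix \<omega> assume "\<omega> \<in> space (PiM UNIV \<Omega>)"
      then have "\<omega> j \<in> space (\<Omega> j)" for j by (auto simp: space_PiM)
      then have "(\<lambda>n. Y j n (\<omega> j)) \<longlonglongrightarrow> Y' j (\<omega> j)" for j by (rule *(6))
      then have "(\<lambda>n. \<chi> j. Y j n (\<omega> j)) \<longlonglongrightarrow> (\<chi> j. Y' j (\<omega> j))" by (intro vec_tendstoI) simp
      then show "(\<lambda>n. f (\<chi> j. Y j n (\<omega> j))) \<longlonglongrightarrow> f (\<chi> j. Y' j (\<omega> j))"
        using f continuous_on_tendsto_compose by fastforce
    qed
  qed (use meas *(2) Y' B in auto)
  moreover have "(\<integral>x. f (\<chi> j. x j) \<partial>PiM UNIV (\<nu> n)) = (\<integral>\<omega>. f (\<chi> j. Y j n (\<omega> j)) \<partial>PiM UNIV \<Omega>)" for n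
  proof -
    have "\<nu> n = (\<lambda>j. distr (\<Omega> j) borel (Y j n))" using *(3) by simp
    then show ?thesis using comp[of "\<lambda>j. Y j n"] *(2) by simp
  qed
  moreover have "(\<integral>x. f (\<chi> j. x j) \<partial>PiM UNIV \<nu>') = (\<integral>\<omega>. f (\<chi> j. Y' j (\<omega> j)) \<partial>PiM UNIV \<Omega>)"
  proof -
    have "\<nu>' = (\<lambda>j. distr (\<Omega> j) borel (Y' j))" using *(5) by simp
    then show ?thesis using comp[of Y'] Y' by simp
  qed
  ultimately show ?thesis by simp
qed

lemma distr_Pi_pmf_injective_coordinates:
  fixes m :: "'k::finite \<Rightarrow> nat" and g :: "'k \<Rightarrow> nat \<Rightarrow> real"
  assumes J: "finite J" and m: "inj m" "range m \<subseteq> J"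
  shows "distr (measure_pmf (Pi_pmf J d p)) (PiM UNIV (\<lambda>_. borel)) (\<lambda>c j. g j (c (m j))) =
     PiM UNIV (\<lambda>j. distr (measure_pmf (p (m j))) borel (g j))"
proof -
  let ?N = "\<lambda>j. distr (measure_pmf (p (m j))) borel (g j)"
  let ?X = "\<lambda>c j. g j (c (m j))"
  let ?P = "measure_pmf (Pi_pmf J d p)"
  have N: "prob_space (?N j)" for j by (rule measure_pmf.prob_space_distr) simp
  interpret product_sigma_finite ?N
    unfolding product_sigma_finite_def using N prob_space_imp_sigma_finite by blast
  have meas: "?X \<in> measurable ?P (PiM UNIV (\<lambda>_. borel))"
  proof -
    have "(\<lambda>c. \<lambda>j\<in>UNIV. g j (c (m j))) \<in> measurable ?P (PiM UNIV (\<lambda>_. borel))"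
      by (intro measurable_restrict) auto
    then show ?thesis by (simp add: restrict_def)
  qed
  show ?thesis
  proof (rule PiM_eqI)
    show "sets (distr ?P (PiM UNIV (\<lambda>_. borel)) ?X) = PiM UNIV ?N"
      by (simp cong: sets_PiM_cong)
    fix A assume "\<And>i. i \<in> (UNIV :: 'k set) \<Longrightarrow> A i \<in> sets (?N i)"
    then have A: "\<And>i. A i \<in> sets borel" by simp
    \<comment> \<open>the constraint on coordinate \<open>i\<close>: none unless \<open>i\<close> is one of the chosen coordinates\<close>
    define D where "D i = (if i \<in> range m then g (inv m i) -` A (inv m i) else UNIV)" for i
    have Dm: "D (m j) = g j -` A j" for j using m(1) by (simp add: D_def)
    have "emeasure (distr ?P (PiM UNIV (\<lambda>_. borel)) ?X) (Pi\<^sub>E UNIV A) = emeasure ?P (?X -` (Pi\<^sub>E UNIV A) \<inter> space ?P)"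
      using A by (intro emeasure_distr meas sets_PiM_I_finite) auto
    also have "?X -` (Pi\<^sub>E UNIV A) \<inter> space ?P = Pi J D"
    proof -
      have "c \<in> Pi J D \<longleftrightarrow> (\<forall>j. g j (c (m j)) \<in> A j)" for c
      proof
        assume c: "c \<in> Pi J D"
        show "\<forall>j. g j (c (m j)) \<in> A j"
        proof
          fix j
          have "c (m j) \<in> D (m j)" using c m(2) by auto
          then show "g j (c (m j)) \<in> A j" unfolding Dm by simp
        qed
      next
        assume c: "\<forall>j. g j (c (m j)) \<in> A j"
        show "c \<in> Pi J D"
        proof (rule Pi_I)
          fix i
          show "c i \<in> D i"
          proof (cases "i \<in> range m")
            case True
            then obtain j where "i = m j" by blast
            then show ?thesis using c Dm by simp
          qed (simp add: D_def)
        qed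
      qed
      then show ?thesis by (auto simp: PiE_iff)
    qed
    also have "emeasure ?P (Pi J D) = ennreal (\<Prod>i\<in>J. measure_pmf.prob (p i) (D i))"
      unfolding measure_pmf.emeasure_eq_measure measure_Pi_pmf_Pi[OF J] ..
    also have "(\<Prod>i\<in>J. measure_pmf.prob (p i) (D i)) = (\<Prod>i\<in>range m. measure_pmf.prob (p i) (D i))"
      using J m by (intro prod.mono_neutral_right) (auto simp: D_def)
    also have "\<dots> = (\<Prod>j\<in>UNIV. measure_pmf.prob (p (m j)) (g j -` A j))"
      using m(1) by (subst prod.reindex) (auto simp: Dm)
    also have "ennreal \<dots> = (\<Prod>j\<in>UNIV. emeasure (?N j) (A j))"
      using A by (subst prod_ennreal[symmetric]) (auto simp: emeasure_distr measure_pmf.emeasure_eq_measure)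
    finally show "emeasure (distr ?P (PiM UNIV (\<lambda>_. borel)) ?X) (Pi\<^sub>E UNIV A) = (\<Prod>i\<in>UNIV. emeasure (?N i) (A i))" .
  qed simp
qed

section \<open>The central limit theorem for cycle counts\<close>

lemma cycle_count_eq_cycle_type: "cycle_count n l \<sigma> = cycle_type {1..n} \<sigma> l"
  by (simp add: cycle_count_def perm_cycles_def cycle_type_def)

lemma integral_distr_independent_normals:
  fixes N :: "'k::finite \<Rightarrow> 'w \<Rightarrow> real" and f :: "real ^ 'k \<Rightarrow> real"
  assumes Q: "prob_space Q"
    and indep: "prob_space.indep_vars Q (\<lambda>_. borel) N UNIV"
    and normal: "\<forall>j. distributed Q lborel (N j) std_normal_density"
    and f: "continuous_on UNIV f"
  shows "(\<integral>v. f v \<partial>distr Q borel (\<lambda>\<omega>. \<chi> j. N j \<omega>)) = (\<integral>x. f (\<chi> j. x j) \<partial>PiM UNIV (\<lambda>_. std_normal_distribution))"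
proof -
  interpret prob_space Q by fact
  have f' [measurable]: "f \<in> borel_measurable borel" using f by (rule borel_measurable_continuous_onI)
  have N: "N j \<in> borel_measurable Q" for j
    using distributed_measurable[OF normal[rule_format, of j]] by simp
  have dN: "distr Q borel (N j) = std_normal_distribution" for j
  proof -
    have "distr Q borel (N j) = distr Q lborel (N j)" by (rule distr_cong) auto
    also have "\<dots> = std_normal_distribution" using normal by (simp add: distributed_distr_eq_density)
    finally show ?thesis .
  qed
  have Nm [measurable]: "(\<lambda>\<omega> j. N j \<omega>) \<in> measurable Q (PiM UNIV (\<lambda>_. borel))"
  proof -
    have "(\<lambda>\<omega>. \<lambda>j\<in>UNIV. N j \<omega>) \<in> measurable Q (PiM UNIV (\<lambda>_. borel))"
      by (intro measurable_restrict N)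
    then show ?thesis by (simp add: restrict_def)
  qed
  have "distr Q (PiM UNIV (\<lambda>_. borel)) (\<lambda>\<omega>. \<lambda>j\<in>UNIV. N j \<omega>) = PiM UNIV (\<lambda>j. distr Q borel (N j))"
    using indep by (subst (asm) indep_vars_iff_distr_eq_PiM') (auto simp: N)
  then have D: "distr Q (PiM UNIV (\<lambda>_. borel)) (\<lambda>\<omega> j. N j \<omega>) = PiM UNIV (\<lambda>_. std_normal_distribution)"
    by (simp add: restrict_def dN)
  have "(\<integral>v. f v \<partial>distr Q borel (\<lambda>\<omega>. \<chi> j. N j \<omega>)) = (\<integral>\<omega>. f (\<chi> j. N j \<omega>) \<partial>Q)"
    using measurable_compose[OF Nm measurable_vec_lambda_PiM] by (intro integral_distr f') simp
  also have "\<dots> = (\<integral>x. f (\<chi> j. x j) \<partial>distr Q (PiM UNIV (\<lambda>_. borel)) (\<lambda>\<omega> j. N j \<omega>))"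
    using measurable_compose[OF measurable_vec_lambda_PiM f'] by (intro integral_distr[symmetric] Nm) simp
  finally show ?thesis unfolding D .
qed

lemma (in saddle) integral_law_normalized:
  fixes m :: "'k::finite \<Rightarrow> nat" and f :: "real ^ 'k \<Rightarrow> real"
  assumes m: "inj m" "range m \<subseteq> {1..N}" and f: "continuous_on UNIV f"
  shows "measure_pmf.expectation law (\<lambda>c. f (\<chi> j. (real (c (m j)) - mu (m j)) / sqrt (mu (m j))))
    = (\<integral>x. f (\<chi> j. x j) \<partial>PiM UNIV (\<lambda>j. std_poisson (mu (m j))))"
proof -
  have f': "f \<in> borel_measurable borel" using f by (rule borel_measurable_continuous_onI)
  let ?X = "\<lambda>c j. (real (c (m j)) - mu (m j)) / sqrt (mu (m j))"
  have "(\<lambda>c. \<lambda>j\<in>UNIV. ?X c j) \<in> measurable (measure_pmf law) (PiM UNIV (\<lambda>_. borel))"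
    by (intro measurable_restrict) auto
  then have X: "?X \<in> measurable (measure_pmf law) (PiM UNIV (\<lambda>_. borel))" by (simp add: restrict_def)
  have "measure_pmf.expectation law (\<lambda>c. f (\<chi> j. ?X c j)) =
      (\<integral>x. f (\<chi> j. x j) \<partial>distr (measure_pmf law) (PiM UNIV (\<lambda>_. borel)) ?X)"
    using measurable_compose[OF measurable_vec_lambda_PiM f'] by (intro integral_distr[symmetric] X) simp
  also have "distr (measure_pmf law) (PiM UNIV (\<lambda>_. borel)) ?X = PiM UNIV (\<lambda>j. std_poisson (mu (m j)))"
    unfolding law_def std_poisson_def
    using distr_Pi_pmf_injective_coordinates[of "{1..N}" m 0 "\<lambda>j. poisson_pmf (mu j)"
        "\<lambda>j k. (real k - mu (m j)) / sqrt (mu (m j))"] m by simp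
  finally show ?thesis .
qed

theorem theorem2p4:
  fixes a1 a2 :: real
    and \<alpha> :: "nat \<Rightarrow> real"
    and m :: "'k::finite \<Rightarrow> nat \<Rightarrow> nat"
    and Q :: "'w measure"
    and N :: "'k \<Rightarrow> 'w \<Rightarrow> real"
  assumes a1: "0 < a1" "a1 < 1"
    and a2: "0 < a2" "a2 < 1"
    and alpha: "\<forall>n\<ge>1. real n powr a1 \<le> \<alpha> n \<and> \<alpha> n \<le> real n powr a2"
    and m_range: "\<forall>j. \<forall>n\<ge>1. 1 \<le> m j n \<and> real (m j n) \<le> \<alpha> n"
    and m_distinct: "\<forall>\<^sub>F n in sequentially. \<forall>i j. i \<noteq> j \<longrightarrow> m i n \<noteq> m j n"
    and mu_infinity: "\<forall>j. filterlim (\<lambda>n. cycle_mu \<alpha> n (m j n)) at_top sequentially"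
    and a1_large: "a1 > 1 / 7"
    and Q: "prob_space Q"
    and N_indep: "prob_space.indep_vars Q (\<lambda>_. borel) N UNIV"
    and N_normal: "\<forall>j. distributed Q lborel (N j) std_normal_density"
  shows "converges_in_distribution
           (\<lambda>n. measure_pmf (short_cycle_pmf \<alpha> n))
           (\<lambda>n \<sigma>. (\<chi> j. normalized_cycle_count \<alpha> n (m j n) \<sigma>) :: real ^ 'k)
           Q (\<lambda>\<omega>. \<chi> j. N j \<omega>)"
proof -
  define k where "k = real CARD('k)"
  define err where "err n = 2 * k * (1 / real n + 4 * ln (real n) / real n powr a1)" for n
  define r where "r n j = cycle_mu \<alpha> n (m j n)" for n j
  have k: "0 \<le> k" by (simp add: k_def)
  note growth = growth_conditions[OF a1 a2 k, folded err_def]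
  show ?thesis
    unfolding converges_in_distribution_def
  proof (intro allI impI, elim conjE)
    fix f :: "real ^ 'k \<Rightarrow> real"
    assume f: "continuous_on UNIV f" and "bounded (range f)"
    then obtain B where B: "\<And>v. \<bar>f v\<bar> \<le> B" by (auto simp: bounded_iff)
    have f': "f \<in> borel_measurable borel" using f by (rule borel_measurable_continuous_onI)
    define E where "E n = (\<integral>v. f v \<partial>distr (measure_pmf (short_cycle_pmf \<alpha> n)) borel
       (\<lambda>\<sigma>. \<chi> j. normalized_cycle_count \<alpha> n (m j n) \<sigma>))" for n
    define I where "I n = (\<integral>x. f (\<chi> j. x j) \<partial>PiM UNIV (\<lambda>j. std_poisson (r n j)))" for n
    let ?I' = "\<integral>x. f (\<chi> j. x j) \<partial>PiM UNIV (\<lambda>_. std_normal_distribution)"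
    \<comment> \<open>the independent Poisson variables satisfy the central limit theorem\<close>
    have I: "I \<longlonglongrightarrow> ?I'"
      unfolding I_def
    proof (rule weak_convergence_product[OF _ _ _ f B])
      show "weak_conv_m (\<lambda>n. std_poisson (r n j)) std_normal_distribution" for j
        unfolding r_def using mu_infinity by (intro poisson_clt) auto
    qed (auto intro: real_distribution_std_poisson real_dist_normal_dist)
    \<comment> \<open>conditioning on the total has a negligible effect on finitely many coordinates\<close>
    have "eventually (\<lambda>n. \<bar>E n - I n\<bar> \<le> 18 * B * sqrt (err n)) sequentially"
      using growth(1,2,3) order_tendstoD(2)[OF growth(4), of "1/2", simplified] growth(5,6) m_distinct eventually_ge_at_top[of 6]
    proof eventually_elim
      case (elim n)
      let ?N = "nat \<lfloor>\<alpha> n\<rfloor>"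
      have n: "1 \<le> n" using elim by simp
      have \<alpha>n: "real n powr a1 \<le> \<alpha> n" "\<alpha> n \<le> real n powr a2" using alpha n by auto
      then have "1 \<le> \<alpha> n" using elim(1) by linarith
      note s = short_cycle_perms_saddle[where \<alpha> = \<alpha> and n = n, OF n this]
      interpret saddle ?N n "saddle_point \<alpha> n" by (rule s(1))
      have N_low: "\<alpha> n - 1 \<le> real ?N" using \<open>1 \<le> \<alpha> n\<close> by linarith
      have N: "real n powr a1 / 2 \<le> real ?N" "real ?N \<le> real n powr a2" "1 \<le> ?N"
      proof -
        show "real n powr a1 / 2 \<le> real ?N" using N_low \<alpha>n(1) elim(1) by linarith
        show "real ?N \<le> real n powr a2" using \<alpha>n(2) \<open>1 \<le> \<alpha> n\<close> by linarith
        show "1 \<le> ?N" using \<open>1 \<le> \<alpha> n\<close> by (simp add: le_nat_iff le_floor_iff)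
      qed
      define M where "M = range (\<lambda>j. m j n)"
      have M: "M \<subseteq> {1..?N}" using m_range n by (auto simp: M_def intro!: le_nat_floor)
      have cardM: "real (card M) \<le> k" unfolding M_def k_def by (simp add: card_image_le)
      have inj: "inj (\<lambda>j. m j n)" using elim(7) by (auto simp: inj_on_def)
      have r_mu: "r n j = mu (m j n)" for j by (simp add: r_def s(3))
      define F where "F c = f (\<chi> j. (real (c (m j n)) - mu (m j n)) / sqrt (mu (m j n)))" for c :: "nat \<Rightarrow> nat"
      have ne: "short \<noteq> {}"
        using id_in_short_cycle_perms[of n \<alpha>] \<open>1 \<le> \<alpha> n\<close> unfolding s(2) by blast
      have "E n = measure_pmf.expectation (short_cycle_pmf \<alpha> n) (\<lambda>\<sigma>. F (cycle_type {1..n} \<sigma>))"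
        unfolding E_def F_def normalized_cycle_count_def cycle_count_eq_cycle_type s(3)
        by (intro integral_distr f') simp
      then have E: "E n = measure_pmf.expectation (pmf_of_set short) (\<lambda>\<sigma>. F (cycle_type {1..n} \<sigma>))"
        by (simp only: short_cycle_pmf_def s(2))
      have I: "I n = measure_pmf.expectation law F"
        unfolding I_def F_def r_mu using M by (intro integral_law_normalized[symmetric] inj f) (simp add: M_def)
      show ?case
        unfolding E I err_def
      proof (rule short_expectation_error[OF N M cardM _ _ ne elim(8) elim(2,3)])
        show "F c = F c'" if "\<And>j. j \<in> M \<Longrightarrow> c j = c' j" for c c'
        proof -
          have "c (m j n) = c' (m j n)" for j using that[of "m j n"] by (simp add: M_def)
          then show ?thesis unfolding F_def by simp
        qed
        show "\<bar>F c\<bar> \<le> B" for c by (simp add: F_def B)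
      qed (use elim(4,5,6) in \<open>auto simp: err_def\<close>)
    qed
    moreover have "(\<lambda>n. 18 * B * sqrt (err n)) \<longlonglongrightarrow> 0"
      using tendsto_real_sqrt[OF growth(4)] by (intro tendsto_mult_right_zero) simp
    ultimately have "(\<lambda>n. E n - I n) \<longlonglongrightarrow> 0"
      by (intro Lim_null_comparison[of "\<lambda>n. E n - I n"]) auto
    then have "(\<lambda>n. (E n - I n) + I n) \<longlonglongrightarrow> 0 + ?I'" using I by (rule tendsto_add)
    then show "(\<lambda>n. \<integral>v. f v \<partial>distr (measure_pmf (short_cycle_pmf \<alpha> n)) borel
       (\<lambda>\<sigma>. \<chi> j. normalized_cycle_count \<alpha> n (m j n) \<sigma>)) \<longlonglongrightarrow> (\<integral>v. f v \<partial>distr Q borel (\<lambda>\<omega>. \<chi> j. N j \<omega>))"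
      unfolding integral_distr_independent_normals[OF Q N_indep N_normal f] by (simp add: E_def)
  qed
qed

end
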